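(* Let $n>1$ be an integer, let $X$ be an $n$-dimensional topological manifold and let $Y\subset X$ be an $(n-1)$-dimensional submanifold. Suppose that $X$ and $Y$ are both connected and non-empty, that $Y$ is a closed subset of $X$, and that $\operatorname{Hom}(H_1(X),\mathbb{Z}/2\mathbb{Z})=0$. Then $X\setminus Y$ has exactly two connected components.
   Context: Manifolds are topological manifolds (without boundary). An $(n-1)$-dimensional submanifold $Y$ of $X$ is a subset which, with the subspace topology, is an $(n-1)$-dimensional topological manifold; no smoothness or local flatness is assumed. $H_1(X)$ is the first singular homology group with integer coefficients, and $\operatorname{Hom}$ denotes group homomorphisms. *)

theory Defs
  imports "HOL-Analysis.Analysis" "HOL-Homology.Homology"
begin

(* Manifolds are Hausdorff and second countable. They have no boundary, since the charts map onto
   open subsets of R^n itself. As usual, the empty space is a manifold of every dimension. *)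
definition topological_manifold :: "nat \<Rightarrow> 'a topology \<Rightarrow> bool" where
  "topological_manifold n X \<longleftrightarrow>
     Hausdorff_space X \<and> second_countable X \<and>
     (\<forall>x \<in> topspace X. \<exists>U V. openin X U \<and> x \<in> U \<and> openin (Euclidean_space n) V \<and>
        subtopology X U homeomorphic_space subtopology (Euclidean_space n) V)"

(* No smoothness or local flatness: Y may be wildly embedded. *)
definition topological_submanifold :: "nat \<Rightarrow> 'a topology \<Rightarrow> 'a set \<Rightarrow> bool" where
  "topological_submanifold m X Y \<longleftrightarrow>
     Y \<subseteq> topspace X \<and> topological_manifold m (subtopology X Y)"

end

theory Submission
  imports Defs
begin

text \<open>
Assume first that near each of its points \<open>Y\<close> has exactly two sides. The two-element sets of sides
form a principal \<open>\<int>/2\<close>-bundle over \<open>Y\<close>, and this extends to \<open>X\<close>: a local section is a locally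
constant function from the complement of \<open>Y\<close> to \<open>\<int>/2\<close> that changes its value across \<open>Y\<close>. Since
\<open>H\<^sup>1(X; \<int>/2) = Hom(H\<^sub>1(X), \<int>/2) = 0\<close>, the bundle is trivial and has a global section, a locally
constant function \<open>F\<close> on \<open>X - Y\<close> that jumps at every point of \<open>Y\<close>. Its level sets are nonempty and open.
They are connected because any other locally constant function on \<open>X - Y\<close> is near each point of \<open>Y\<close> constant or
equal to \<open>F\<close> up to a constant, and by connectedness of \<open>Y\<close> and \<open>X\<close> the same alternative holds globally
(\<open>connected_side\<close>).

The bundle argument is elementary: monodromy along paths is well defined because a double cover is trivial over a
square, it defines a cocycle modulo 2 on singular 1-chains, and the hypothesis on \<open>H\<^sub>1\<close> makes it independent of the path
(\<open>global_section_exists\<close>).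

As \<open>Y\<close> may be wildly embedded, the local two-sidedness is the main point. Take a coordinate neighbourhood \<open>W\<close>,
a copy of \<open>\<real>\<^bsup>m+1\<^esup>\<close> with \<open>m = n - 1\<close>, so small that \<open>W \<inter> Y\<close> lies in a chart of \<open>Y\<close>. The component
\<open>M\<close> of \<open>W \<inter> Y\<close> through the given point is closed in \<open>W\<close> and homeomorphic to a connected open set
\<open>U\<close> of \<open>\<real>\<^sup>m\<close>. The number of components of the complement of a closed subset of a Euclidean space depends only
on the homeomorphism type of the subset, and \<open>U\<close> has a tame closed copy, the graph of a function on \<open>U\<close> that tends
to infinity at the frontier. So \<open>W - M\<close> has exactly two components, and removing a relatively open piece from
\<open>M\<close> joins them; hence every point of \<open>M\<close> is in the closure of both (\<open>closed_hypersurface_sides\<close>). The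
remaining components of \<open>W \<inter> Y\<close> could still create further germs of sides. They do not, because a locally constant
function on \<open>W - Y\<close> splits as a sum of one on \<open>W - M\<close> and one on the complement of the other components, which is again
the triviality of double covers, now over the contractible space \<open>W\<close> (\<open>germ_from_sides\<close>).
\<close>

section \<open>Lifting to double covers\<close>

text \<open>Points of \<open>Y\<close> are ignored throughout: functions matter only off \<open>Y\<close>, whose complement will be dense.
Functions valued in \<open>bool\<close> stand for functions valued in \<open>\<int>/2\<close>, with addition \<open>(\<noteq>)\<close>.\<close>

definition agree_near :: "'a topology \<Rightarrow> 'a set \<Rightarrow> 'a \<Rightarrow> ('a \<Rightarrow> bool) \<Rightarrow> ('a \<Rightarrow> bool) \<Rightarrow> bool" where
  "agree_near X Y z a b \<longleftrightarrow> (\<exists>N. openin X N \<and> z \<in> N \<and> (\<forall>w\<in>N - Y. a w = b w))"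

lemma agree_nearI:
  "\<lbrakk>openin X N; z \<in> N; \<And>w. w \<in> N \<Longrightarrow> w \<notin> Y \<Longrightarrow> a w = b w\<rbrakk> \<Longrightarrow> agree_near X Y z a b"
  unfolding agree_near_def by blast

lemma agree_near_refl: "z \<in> topspace X \<Longrightarrow> agree_near X Y z a a"
  unfolding agree_near_def by blast

lemma agree_near_sym: "agree_near X Y z a b \<Longrightarrow> agree_near X Y z b a"
  unfolding agree_near_def by metis

lemma agree_near_trans:
  assumes "agree_near X Y z a b" "agree_near X Y z b c"
  shows "agree_near X Y z a c"
proof -
  obtain N N' where "openin X N" "z \<in> N" "\<forall>w\<in>N - Y. a w = b w"
    and "openin X N'" "z \<in> N'" "\<forall>w\<in>N' - Y. b w = c w"
    using assms unfolding agree_near_def by blast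
  then show ?thesis
    by (intro agree_nearI[of X "N \<inter> N'"]) auto
qed

lemma agree_near_eventually:
  assumes "agree_near X Y z a b"
  obtains N where "openin X N" "z \<in> N" "\<And>w. w \<in> N \<Longrightarrow> agree_near X Y w a b"
  using assms unfolding agree_near_def by blast

text \<open>A principal \<open>\<int>/2\<close>-bundle, given by germs. The fibre over \<open>x\<close> consists of the germs at \<open>x\<close>
of \<open>f x\<close> and of its negation, and the second assumption says that the germs of \<open>f x\<close> at the points near
\<open>x\<close> trivialise the bundle there. Density of the complement of \<open>Y\<close> makes the two elements of each fibre distinct.\<close>

locale double_cover =
  fixes X :: "'a topology" and Y :: "'a set" and f :: "'a \<Rightarrow> 'a \<Rightarrow> bool"
  assumes dense: "\<And>N z. openin X N \<Longrightarrow> z \<in> N \<Longrightarrow> \<exists>w\<in>N. w \<notin> Y"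
    and locally_constant:
      "\<And>x. x \<in> topspace X \<Longrightarrow>
        \<exists>N. openin X N \<and> x \<in> N \<and> (\<forall>z\<in>N. \<exists>k. agree_near X Y z (f x) (\<lambda>w. f z w \<noteq> k))"
begin

abbreviation agrees :: "'a \<Rightarrow> ('a \<Rightarrow> bool) \<Rightarrow> ('a \<Rightarrow> bool) \<Rightarrow> bool" where
  "agrees \<equiv> agree_near X Y"

text \<open>A lift of \<open>u\<close> to the double cover is recorded by the map \<open>s\<close> that compares it with the chosen germs:
over \<open>p\<close> the lift is the germ of \<open>\<lambda>w. s p \<noteq> f (u p) w\<close>. Continuity of the lift means that near \<open>p\<close>
it is the germ of one fixed function.\<close>

definition same_sheet :: "('b \<Rightarrow> 'a) \<Rightarrow> ('b \<Rightarrow> bool) \<Rightarrow> 'b \<Rightarrow> 'b \<Rightarrow> bool" where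
  "same_sheet u s p q \<longleftrightarrow> agrees (u q) (\<lambda>w. s p \<noteq> f (u p) w) (\<lambda>w. s q \<noteq> f (u q) w)"

definition lift_on :: "('b::topological_space \<Rightarrow> 'a) \<Rightarrow> 'b set \<Rightarrow> ('b \<Rightarrow> bool) \<Rightarrow> bool" where
  "lift_on u A s \<longleftrightarrow> (\<forall>p\<in>A. \<exists>T. open T \<and> p \<in> T \<and> (\<forall>q\<in>A \<inter> T. same_sheet u s p q))"

lemma lift_onD:
  assumes "lift_on u A s" "p \<in> A"
  obtains T where "open T" "p \<in> T" "\<forall>q\<in>A \<inter> T. same_sheet u s p q"
  using assms unfolding lift_on_def by meson

lemma lift_onI:
  assumes "\<And>p. p \<in> A \<Longrightarrow> \<exists>T. open T \<and> p \<in> T \<and> (\<forall>q\<in>A \<inter> T. same_sheet u s p q)"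
  shows "lift_on u A s"
  unfolding lift_on_def by (intro ballI assms)

lemma lift_on_subset:
  assumes "lift_on u A s" "B \<subseteq> A"
  shows "lift_on u B s"
proof (rule lift_onI)
  fix p assume "p \<in> B"
  then have p: "p \<in> A" using assms by auto
  obtain T where T: "open T" "p \<in> T" "\<forall>q\<in>A \<inter> T. same_sheet u s p q"
    by (rule lift_onD[OF assms(1) p])
  then show "\<exists>T. open T \<and> p \<in> T \<and> (\<forall>q\<in>B \<inter> T. same_sheet u s p q)"
    using assms(2) by (intro exI[of _ T]) auto
qed

lemma lift_on_cong:
  assumes "lift_on u A s" "\<And>p. p \<in> A \<Longrightarrow> u p = v p" "\<And>p. p \<in> A \<Longrightarrow> s p = t p"
  shows "lift_on v A t"
proof (rule lift_onI)
  fix p assume p: "p \<in> A"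
  obtain T where T: "open T" "p \<in> T" "\<forall>q\<in>A \<inter> T. same_sheet u s p q"
    by (rule lift_onD[OF assms(1) p])
  have "same_sheet v t p q" if "q \<in> A" "q \<in> T" for q
    using T(3) assms(2,3) p that by (simp add: same_sheet_def)
  with T show "\<exists>T. open T \<and> p \<in> T \<and> (\<forall>q\<in>A \<inter> T. same_sheet v t p q)"
    by blast
qed

lemma same_sheet_flip:
  assumes "same_sheet u s p q"
  shows "same_sheet u (\<lambda>p. s p \<noteq> k) p q"
proof -
  obtain N where N: "openin X N" "u q \<in> N" and eq: "\<And>w. w \<in> N - Y \<Longrightarrow> (s p \<noteq> f (u p) w) = (s q \<noteq> f (u q) w)"
    using assms unfolding same_sheet_def agree_near_def by blast
  show ?thesis
    unfolding same_sheet_def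
  proof (rule agree_nearI[OF N])
    fix w assume "w \<in> N" "w \<notin> Y"
    with eq[of w] show "((s p \<noteq> k) \<noteq> f (u p) w) = ((s q \<noteq> k) \<noteq> f (u q) w)"
      by auto
  qed
qed

lemma lift_on_flip:
  assumes "lift_on u A s"
  shows "lift_on u A (\<lambda>p. s p \<noteq> k)"
proof (rule lift_onI)
  fix p assume p: "p \<in> A"
  obtain T where "open T" "p \<in> T" "\<forall>q\<in>A \<inter> T. same_sheet u s p q"
    by (rule lift_onD[OF assms p])
  then show "\<exists>T. open T \<and> p \<in> T \<and> (\<forall>q\<in>A \<inter> T. same_sheet u (\<lambda>p. s p \<noteq> k) p q)"
    by (intro exI[of _ T] conjI ballI same_sheet_flip) simp_all
qed

lemma lift_on_compose:
  assumes "lift_on u A s" "continuous_on B v" "v ` B \<subseteq> A"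
  shows "lift_on (u \<circ> v) B (s \<circ> v)"
proof (rule lift_onI)
  fix p assume p: "p \<in> B"
  then have "v p \<in> A" using assms by auto
  obtain T where T: "open T" "v p \<in> T" "\<forall>q\<in>A \<inter> T. same_sheet u s (v p) q"
    by (rule lift_onD[OF assms(1) \<open>v p \<in> A\<close>])
  obtain T' where T': "open T'" "T' \<inter> B = v -` T \<inter> B"
    using assms(2) T(1) by (metis continuous_on_open_invariant)
  have "same_sheet (u \<circ> v) (s \<circ> v) p q" if "q \<in> B" "q \<in> T'" for q
    using T(3) T' that assms(3) by (auto simp: same_sheet_def)
  moreover have "p \<in> T'"
    using T(2) T'(2) p by blast
  ultimately show "\<exists>T. open T \<and> p \<in> T \<and> (\<forall>q\<in>B \<inter> T. same_sheet (u \<circ> v) (s \<circ> v) p q)"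
    using T'(1) by blast
qed

lemma same_sheet_diff:
  assumes "same_sheet u s p q" "same_sheet u t p q"
  shows "(s q \<noteq> t q) = (s p \<noteq> t p)"
proof -
  obtain M where M: "openin X M" "u q \<in> M" "\<And>w. w \<in> M - Y \<Longrightarrow> (s p \<noteq> f (u p) w) = (s q \<noteq> f (u q) w)"
    using assms(1) unfolding same_sheet_def agree_near_def by blast
  obtain N where N: "openin X N" "u q \<in> N" "\<And>w. w \<in> N - Y \<Longrightarrow> (t p \<noteq> f (u p) w) = (t q \<noteq> f (u q) w)"
    using assms(2) unfolding same_sheet_def agree_near_def by blast
  obtain w where "w \<in> M \<inter> N" "w \<notin> Y"
    using dense[of "M \<inter> N" "u q"] M N by blast
  then show ?thesis
    using M(3)[of w] N(3)[of w] by auto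
qed

text \<open>Two lifts differ by a locally constant deck transformation.\<close>

lemma lift_on_unique:
  assumes s: "lift_on u A s" and t: "lift_on u A t" and "connected A"
  obtains k where "\<And>p. p \<in> A \<Longrightarrow> t p = (s p \<noteq> k)"
proof -
  have "\<exists>V. openin (top_of_set A) V \<and> p \<in> V \<and> (\<forall>q\<in>V. (s q \<noteq> t q) = (s p \<noteq> t p))"
    if p: "p \<in> A" for p
  proof -
    obtain S where S: "open S" "p \<in> S" "\<forall>q\<in>A \<inter> S. same_sheet u s p q"
      by (rule lift_onD[OF s p])
    obtain T where T: "open T" "p \<in> T" "\<forall>q\<in>A \<inter> T. same_sheet u t p q"
      by (rule lift_onD[OF t p])
    have "(s q \<noteq> t q) = (s p \<noteq> t p)" if "q \<in> A \<inter> (S \<inter> T)" for q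
      by (rule same_sheet_diff[where u=u]) (use S(3) T(3) that in auto)
    moreover have "openin (top_of_set A) (A \<inter> (S \<inter> T))"
      using S T by (intro openin_open_Int open_Int)
    ultimately show ?thesis
      using S T p by blast
  qed
  then have "(\<lambda>q. s q \<noteq> t q) constant_on A"
    by (rule locally_constant_imp_constant[OF \<open>connected A\<close>])
  then obtain k where k: "\<forall>q\<in>A. (s q \<noteq> t q) = k"
    unfolding constant_on_def by (rule exE)
  have "t p = (s p \<noteq> k)" if "p \<in> A" for p
    using bspec[OF k that] by argo
  then show thesis
    by (rule that)
qed

text \<open>Over a connected overlap the two lifts differ by a constant, so one of them can be flipped to match the other.\<close>

lemma lift_on_glue:
  assumes s: "lift_on u A s" and t: "lift_on u B t" and "closed A" "closed B"
    and "connected (A \<inter> B)"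
  obtains r where "lift_on u (A \<union> B) r"
proof -
  obtain k where k: "\<And>p. p \<in> A \<inter> B \<Longrightarrow> s p = (t p \<noteq> k)"
    using lift_on_unique[OF lift_on_subset[OF t] lift_on_subset[OF s] \<open>connected (A \<inter> B)\<close>]
    by blast
  define r where "r \<equiv> \<lambda>p. if p \<in> A then s p else t p \<noteq> k"
  have rA: "lift_on u A r"
    by (rule lift_on_cong[OF s]) (auto simp: r_def)
  have rB: "lift_on u B r"
    by (rule lift_on_cong[OF lift_on_flip[OF t, of k]]) (use k in \<open>auto simp: r_def\<close>)
  have nbhd: "\<exists>T. open T \<and> p \<in> T \<and> (\<forall>q\<in>C \<inter> T. same_sheet u r p q)"
    if "lift_on u C r" "closed C" for C p
  proof (cases "p \<in> C")
    case True
    then show ?thesis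
      using that(1) unfolding lift_on_def by meson
  next
    case False
    then show ?thesis
      using that(2) by (intro exI[of _ "- C"]) auto
  qed
  have "lift_on u (A \<union> B) r"
  proof (rule lift_onI)
    fix p
    obtain S where S: "open S" "p \<in> S" "\<forall>q\<in>A \<inter> S. same_sheet u r p q"
      using nbhd[OF rA \<open>closed A\<close>] by blast
    obtain T where T: "open T" "p \<in> T" "\<forall>q\<in>B \<inter> T. same_sheet u r p q"
      using nbhd[OF rB \<open>closed B\<close>] by blast
    show "\<exists>T. open T \<and> p \<in> T \<and> (\<forall>q\<in>(A \<union> B) \<inter> T. same_sheet u r p q)"
      by (rule exI[of _ "S \<inter> T"]) (use S T in auto)
  qed
  then show thesis
    by (rule that)
qed

text \<open>The transition functions of the bundle, which are at the same time its local sections.\<close>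

definition transition :: "'a \<Rightarrow> 'a \<Rightarrow> bool" where
  "transition x z = (SOME k. agrees z (f x) (\<lambda>w. f z w \<noteq> k))"

lemma transition_nbhd:
  assumes "x \<in> topspace X"
  obtains N where "openin X N" "x \<in> N"
    "\<And>z. z \<in> N \<Longrightarrow> agrees z (f x) (\<lambda>w. transition x z \<noteq> f z w)"
proof -
  obtain N where N: "openin X N" "x \<in> N" "\<And>z. z \<in> N \<Longrightarrow> \<exists>k. agrees z (f x) (\<lambda>w. f z w \<noteq> k)"
    using locally_constant[OF assms] by blast
  have "agrees z (f x) (\<lambda>w. transition x z \<noteq> f z w)" if "z \<in> N" for z
  proof -
    have "agrees z (f x) (\<lambda>w. f z w \<noteq> transition x z)"
      unfolding transition_def by (rule someI_ex[OF N(3)[OF that]])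
    moreover have "(\<lambda>w. f z w \<noteq> transition x z) = (\<lambda>w. transition x z \<noteq> f z w)"
      by auto
    ultimately show ?thesis by simp
  qed
  with N that show thesis by blast
qed

lemma lift_on_transition:
  assumes N: "openin X N" "\<And>z. z \<in> N \<Longrightarrow> agrees z (f x) (\<lambda>w. transition x z \<noteq> f z w)"
    and u: "continuous_map (top_of_set A) X u" "u ` A \<subseteq> N"
  shows "lift_on u A (\<lambda>p. transition x (u p))"
proof (rule lift_onI)
  fix p assume p: "p \<in> A"
  then have "u p \<in> N" using u by auto
  obtain M where M: "openin X M" "u p \<in> M"
    "\<And>z. z \<in> M \<Longrightarrow> agrees z (f x) (\<lambda>w. transition x (u p) \<noteq> f (u p) w)"
    using agree_near_eventually[OF N(2)[OF \<open>u p \<in> N\<close>]] by blast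
  have "openin (top_of_set A) {q \<in> A. u q \<in> M}"
    using openin_continuous_map_preimage[OF u(1) M(1)] by simp
  then obtain T where T: "open T" "{q \<in> A. u q \<in> M} = A \<inter> T"
    by (meson openin_open)
  have "same_sheet u (\<lambda>p. transition x (u p)) p q" if "q \<in> A \<inter> T" for q
  proof -
    have "u q \<in> M" "u q \<in> N" using T u that by auto
    then show ?thesis
      unfolding same_sheet_def using M(3) N(2) agree_near_sym agree_near_trans by metis
  qed
  then show "\<exists>T. open T \<and> p \<in> T \<and> (\<forall>q\<in>A \<inter> T. same_sheet u (\<lambda>p. transition x (u p)) p q)"
    using T M p by blast
qed

lemma lift_on_locally:
  assumes u: "continuous_map (top_of_set A) X u" and "p \<in> A"
  obtains T s where "open T" "p \<in> T" "lift_on u (A \<inter> T) s"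
proof -
  have "u p \<in> topspace X"
    using u \<open>p \<in> A\<close> by (metis continuous_map_image_subset_topspace image_subset_iff topspace_euclidean_subtopology)
  then obtain N where N: "openin X N" "u p \<in> N"
    "\<And>z. z \<in> N \<Longrightarrow> agrees z (f (u p)) (\<lambda>w. transition (u p) z \<noteq> f z w)"
    using transition_nbhd[of "u p"] by metis
  have "openin (top_of_set A) {q \<in> A. u q \<in> N}"
    using openin_continuous_map_preimage[OF u(1) N(1)] by simp
  then obtain T where T: "open T" "{q \<in> A. u q \<in> N} = A \<inter> T"
    by (meson openin_open)
  have "lift_on u (A \<inter> T) (\<lambda>q. transition (u p) (u q))"
  proof (rule lift_on_transition[OF N(1) N(3)])
    show "continuous_map (top_of_set (A \<inter> T)) X u"
      by (metis continuous_map_from_subtopology_mono inf.cobounded1 u)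
  qed (use T in auto)
  then show thesis
    using that T N \<open>p \<in> A\<close> by blast
qed

text \<open>The square is contractible, so the bundle is trivial over it. The proof subdivides: by the one-dimensional
bisection principle in the second variable there is a lift over a thin vertical strip about each first coordinate, and
by the same principle in the first variable the strips are glued together. Every overlap is a rectangle, hence connected.\<close>

lemma lift_on_square_exists:
  fixes u :: "real \<times> real \<Rightarrow> 'a"
  assumes u: "continuous_map (top_of_set ({0..1} \<times> {0..1})) X u"
  obtains s where "lift_on u ({0..1} \<times> {0..1}) s"
proof -
  define R :: "real \<Rightarrow> real \<Rightarrow> real \<Rightarrow> real \<Rightarrow> (real \<times> real) set" where "R \<equiv> \<lambda>a b c d::real. ({a..b} \<inter> {0..1}) \<times> ({c..d} \<inter> {0..1})"
  have closed_R: "closed (R a b c d)" for a b c d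
    unfolding R_def by (intro closed_Times closed_Int) auto
  have conn_R: "connected (R a b c d)" for a b c d
    unfolding R_def by (intro convex_connected convex_Times convex_Int) auto
  have strip: "\<exists>\<delta>>0. \<exists>s. lift_on u (R (x - \<delta>) (x + \<delta>) 0 1) s" if x: "x \<in> {0..1}" for x
  proof -
    define P where "P \<equiv> \<lambda>c d. \<exists>\<delta>>0. \<exists>s. lift_on u (R (x - \<delta>) (x + \<delta>) c d) s"
    have "P 0 1"
      using zero_le_one
    proof (induction rule: Bolzano)
      case (trans a b c)
      then obtain \<delta> \<epsilon> s t where h: "\<delta> > 0" "lift_on u (R (x - \<delta>) (x + \<delta>) a b) s"
        "\<epsilon> > 0" "lift_on u (R (x - \<epsilon>) (x + \<epsilon>) b c) t"
        unfolding P_def by blast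
      define \<eta> where "\<eta> = min \<delta> \<epsilon>"
      have "lift_on u (R (x - \<eta>) (x + \<eta>) a b) s" "lift_on u (R (x - \<eta>) (x + \<eta>) b c) t"
        by (rule lift_on_subset[OF h(2)] lift_on_subset[OF h(4)], auto simp: R_def \<eta>_def)+
      moreover have "R (x - \<eta>) (x + \<eta>) a b \<inter> R (x - \<eta>) (x + \<eta>) b c = R (x - \<eta>) (x + \<eta>) b b"
        using trans by (auto simp: R_def)
      moreover have "R (x - \<eta>) (x + \<eta>) a b \<union> R (x - \<eta>) (x + \<eta>) b c = R (x - \<eta>) (x + \<eta>) a c"
        using trans by (auto simp: R_def)
      ultimately have "\<exists>r. lift_on u (R (x - \<eta>) (x + \<eta>) a c) r"
        by (metis lift_on_glue closed_R conn_R)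
      then show ?case
        unfolding P_def using h by (intro exI[of _ \<eta>]) (auto simp: \<eta>_def)
    next
      case (local y)
      then have "(x, y) \<in> {0..1} \<times> {0..1}" using x by auto
      then obtain T s where T: "open T" "(x, y) \<in> T" "lift_on u (({0..1} \<times> {0..1}) \<inter> T) s"
        using lift_on_locally[OF u] by metis
      then obtain A B where "open A" "open B" "x \<in> A" "y \<in> B" "A \<times> B \<subseteq> T"
        by (metis mem_Times_iff open_prod_elim fst_conv snd_conv)
      moreover obtain d where "d > 0" "cball x d \<subseteq> A"
        using \<open>open A\<close> \<open>x \<in> A\<close> open_contains_cball by blast
      moreover obtain e where "e > 0" "cball y e \<subseteq> B"
        using \<open>open B\<close> \<open>y \<in> B\<close> open_contains_cball by blast
      ultimately have sub: "cball x d \<times> cball y e \<subseteq> T" by blast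
      have "P a b" if "a \<le> y" "y \<le> b" "b - a < e" for a b
      proof -
        have "R (x - d) (x + d) a b \<subseteq> ({0..1} \<times> {0..1}) \<inter> T"
          using that sub unfolding R_def
          by (auto simp: dist_real_def subset_iff abs_le_iff)
        then show ?thesis
          unfolding P_def using T(3) lift_on_subset \<open>d > 0\<close> by blast
      qed
      then show ?case using \<open>e > 0\<close> by blast
    qed
    then show ?thesis unfolding P_def .
  qed
  define P where "P \<equiv> \<lambda>a b. \<exists>s. lift_on u (R a b 0 1) s"
  have "P 0 1"
    using zero_le_one
  proof (induction rule: Bolzano)
    case (trans a b c)
    then obtain s t where "lift_on u (R a b 0 1) s" "lift_on u (R b c 0 1) t"
      unfolding P_def by blast
    moreover have "R a b 0 1 \<inter> R b c 0 1 = R b b 0 1" "R a b 0 1 \<union> R b c 0 1 = R a c 0 1"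
      using trans by (auto simp: R_def)
    ultimately show ?case
      unfolding P_def by (metis lift_on_glue closed_R conn_R)
  next
    case (local x)
    then obtain d s where d: "d > 0" "lift_on u (R (x - d) (x + d) 0 1) s"
      using strip by (meson atLeastAtMost_iff)
    have "P a b" if "a \<le> x" "x \<le> b" "b - a < d" for a b
    proof -
      have "R a b 0 1 \<subseteq> R (x - d) (x + d) 0 1"
        using that by (auto simp: R_def)
      then show ?thesis
        unfolding P_def using d lift_on_subset by blast
    qed
    then show ?case using d by blast
  qed
  then show thesis
    using that unfolding P_def R_def by auto
qed

lemma lift_on_path_exists:
  fixes \<gamma> :: "real \<Rightarrow> 'a"
  assumes "continuous_map (top_of_set {0..1}) X \<gamma>"
  obtains s where "lift_on \<gamma> {0..1} s"
proof -
  have "continuous_map (top_of_set ({0..1} \<times> {0..1})) (top_of_set {0..1}) (fst :: real \<times> real \<Rightarrow> real)"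
    by (auto intro: continuous_on_fst continuous_on_id)
  then have "continuous_map (top_of_set ({0..1::real} \<times> {0..1::real})) X (\<gamma> \<circ> fst)"
    using assms continuous_map_compose by blast
  then obtain s where "lift_on (\<gamma> \<circ> fst) ({0..1::real} \<times> {0..1::real}) s"
    by (rule lift_on_square_exists)
  then have "lift_on ((\<gamma> \<circ> fst) \<circ> (\<lambda>t::real. (t, 0::real))) {0..1} (s \<circ> (\<lambda>t. (t, 0)))"
    by (rule lift_on_compose) (auto intro!: continuous_intros)
  then show thesis
    using that by (simp add: o_def)
qed

text \<open>The monodromy of a path relative to the chosen germs at its two ends.\<close>

definition transport :: "(real \<Rightarrow> 'a) \<Rightarrow> bool" where
  "transport \<gamma> \<longleftrightarrow> (\<exists>s. lift_on \<gamma> {0..1} s \<and> s 0 \<noteq> s 1)"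

lemma transport_eq:
  assumes "lift_on \<gamma> {0..1} s"
  shows "transport \<gamma> \<longleftrightarrow> s 0 \<noteq> s 1"
proof -
  have "(t 0 \<noteq> t 1) = (s 0 \<noteq> s 1)" if t: "lift_on \<gamma> {0..1} t" for t :: "real \<Rightarrow> bool"
  proof -
    obtain k where "\<And>p. p \<in> {0..1} \<Longrightarrow> t p = (s p \<noteq> k)"
      using lift_on_unique[OF assms t connected_Icc] by blast
    from this[of 0] this[of 1] show ?thesis by auto
  qed
  then show ?thesis
    using assms unfolding transport_def by blast
qed

lemma transport_cong:
  assumes "continuous_map (top_of_set {0..1}) X \<gamma>" "\<And>t. t \<in> {0..1} \<Longrightarrow> \<gamma> t = \<gamma>' t"
  shows "transport \<gamma> = transport \<gamma>'"
proof -
  obtain s where s: "lift_on \<gamma> {0..1} s"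
    using lift_on_path_exists[OF assms(1)] .
  from transport_eq[OF s] transport_eq[OF lift_on_cong[OF s assms(2)], of s] show ?thesis
    by simp
qed

lemma not_transport_const:
  assumes "z \<in> topspace X"
  shows "\<not> transport (\<lambda>t. z)"
proof -
  have "lift_on (\<lambda>t::real. z) {0..1} (\<lambda>t. True)"
    using assms by (auto intro!: lift_onI exI[of _ UNIV] agree_near_refl simp: same_sheet_def)
  from transport_eq[OF this] show ?thesis by simp
qed

text \<open>Homotopy invariance of the monodromy: all four sides are read off from one lift over the whole square.\<close>

lemma transport_square:
  fixes u :: "real \<times> real \<Rightarrow> 'a"
  assumes "continuous_map (top_of_set ({0..1} \<times> {0..1})) X u"
  shows "(transport (\<lambda>t. u (t, 0)) \<noteq> transport (\<lambda>t. u (1, t)))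
       = (transport (\<lambda>t. u (0, t)) \<noteq> transport (\<lambda>t. u (t, 1)))"
proof -
  obtain s where s: "lift_on u ({0..1} \<times> {0..1}) s"
    using lift_on_square_exists[OF assms] .
  have *: "transport (\<lambda>t. u (v t)) \<longleftrightarrow> s (v 0) \<noteq> s (v 1)"
    if "continuous_on {0..1} v" "v ` {0..1} \<subseteq> {0..1} \<times> {0..1}" for v :: "real \<Rightarrow> real \<times> real"
    using transport_eq[OF lift_on_compose[OF s that]] by (simp add: o_def)
  have "transport (\<lambda>t. u (t, 0)) \<longleftrightarrow> s (0,0) \<noteq> s (1,0)"
       "transport (\<lambda>t. u (1, t)) \<longleftrightarrow> s (1,0) \<noteq> s (1,1)"
       "transport (\<lambda>t. u (0, t)) \<longleftrightarrow> s (0,0) \<noteq> s (0,1)"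
       "transport (\<lambda>t. u (t, 1)) \<longleftrightarrow> s (0,1) \<noteq> s (1,1)"
    by (rule *; auto intro!: continuous_intros)+
  then show ?thesis by blast
qed

end

section \<open>Double covers and the first homology group\<close>

text \<open>By universal coefficients this is the vanishing of \<open>H\<^sup>1(X; \<int>/2)\<close>.\<close>

definition no_mod2_cohomology :: "'a topology \<Rightarrow> bool" where
  "no_mod2_cohomology X \<longleftrightarrow>
     (\<forall>h \<in> hom (homology_group 1 X) (integer_mod_group 2).
        trivial_homomorphism (homology_group 1 X) (integer_mod_group 2) h)"

text \<open>Reduced modulo 2, \<open>\<psi>\<close> kills boundaries and so induces a homomorphism on \<open>H\<^sub>1\<close>, which is zero by hypothesis.\<close>

lemma even_on_cycles:
  fixes \<psi> :: "'a chain \<Rightarrow> int"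
  assumes trivial: "no_mod2_cohomology X"
    and add: "\<And>a b. \<psi> (a + b) = \<psi> a + \<psi> b"
    and bdry: "\<And>d. singular_chain 2 X d \<Longrightarrow> even (\<psi> (chain_boundary 2 d))"
    and c: "singular_relcycle 1 X {} c"
  shows "even (\<psi> c)"
proof -
  let ?G = "relcycle_group 1 X {}" and ?N = "singular_relboundary_set 1 X {}"
  have diff: "\<psi> (a - b) = \<psi> a - \<psi> b" for a b
    using add[of "a - b" b] by simp
  have hom: "(\<lambda>c. \<psi> c mod 2) \<in> hom ?G (integer_mod_group 2)"
    by (rule homI) (auto simp: carrier_integer_mod_group add mod_add_eq)
  have wd: "\<psi> a mod 2 = \<psi> b mod 2" if "r_coset ?G ?N a = r_coset ?G ?N b" for a b
  proof -
    have "homologous_rel 1 X {} a = homologous_rel 1 X {} b"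
      using that unfolding right_coset_singular_relboundary by auto
    then have "homologous_rel 1 X {} a b"
      by simp
    then have "singular_relboundary 1 X {} (a - b)"
      by (simp add: homologous_rel_def)
    then obtain d where "singular_chain 2 X d" "chain_boundary 2 d = a - b"
      by (auto simp: singular_boundary numeral_2_eq_2)
    then have "even (\<psi> a - \<psi> b)"
      using bdry[of d] by (simp add: diff)
    then show ?thesis
      by (simp add: mod_eq_dvd_iff)
  qed
  obtain g where g: "g \<in> hom (?G Mod ?N) (integer_mod_group 2)"
    "\<And>x. x \<in> carrier ?G \<Longrightarrow> g (r_coset ?G ?N x) = \<psi> x mod 2"
    using FactGroup_universal[OF hom normal_subgroup_singular_relboundary_relcycle] wd by metis
  have G: "homology_group 1 X = ?G Mod ?N"
    by (simp add: relative_homology_group_def)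
  have "c \<in> carrier ?G"
    using c by simp
  then have "r_coset ?G ?N c \<in> carrier (?G Mod ?N)"
    by (auto simp: FactGroup_def RCOSETS_def)
  then have "g (r_coset ?G ?N c) = 0"
    using trivial g(1) unfolding no_mod2_cohomology_def G trivial_homomorphism_def
    by simp
  then show ?thesis
    using g(2)[OF \<open>c \<in> carrier ?G\<close>] by presburger
qed

definition edge :: "real \<Rightarrow> nat \<Rightarrow> real" where
  "edge t = (\<lambda>i. if i = 0 then 1 - t else if i = 1 then t else 0)"

lemma edge_in_simplex: "t \<in> {0..1} \<Longrightarrow> edge t \<in> standard_simplex 1"
  by (auto simp: edge_def standard_simplex_def)

lemma continuous_edge:
  "continuous_map (top_of_set {0..1}) (subtopology (powertop_real UNIV) (standard_simplex 1)) edge"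
proof -
  have "continuous_map (top_of_set {0..1}) euclideanreal (\<lambda>t. edge t i)" for i
    by (cases "i = 0"; cases "i = 1") (auto simp: edge_def intro!: continuous_intros)
  then show ?thesis
    using edge_in_simplex
    by (auto simp: continuous_map_in_subtopology continuous_map_componentwise_UNIV)
qed

text \<open>The map of the square onto the 2-simplex that collapses the left side to a vertex. The bottom, the right and the
top side are carried to the three edges.\<close>

definition triangle :: "real \<times> real \<Rightarrow> nat \<Rightarrow> real" where
  "triangle = (\<lambda>(x, y) i. if i = 0 then 1 - x else if i = 1 then x * (1 - y)
                 else if i = 2 then x * y else 0)"

lemma triangle_in_simplex:
  assumes "p \<in> {0..1} \<times> {0..1}"
  shows "triangle p \<in> standard_simplex 2"
proof -
  obtain x y where p: "p = (x, y)" "0 \<le> x" "x \<le> 1" "0 \<le> y" "y \<le> 1"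
    using assms by auto
  have "x * y \<le> 1" "x * (1 - y) \<le> 1" "x * y \<le> x"
    using p by (auto intro!: mult_le_one mult_left_le)
  then show ?thesis
    using p by (auto simp: triangle_def standard_simplex_def numeral_2_eq_2 algebra_simps)
qed

lemma continuous_triangle:
  "continuous_map (top_of_set ({0..1} \<times> {0..1}))
     (subtopology (powertop_real UNIV) (standard_simplex 2)) triangle"
proof -
  have "continuous_map (top_of_set ({0..1} \<times> {0..1})) euclideanreal (\<lambda>p. triangle p i)" for i
    by (cases "i = 0"; cases "i = 1"; cases "i = 2")
       (auto simp: triangle_def case_prod_unfold intro!: continuous_intros)
  then show ?thesis
    using triangle_in_simplex
    by (auto simp: continuous_map_in_subtopology continuous_map_componentwise_UNIV)
qed

definition join_paths :: "(real \<Rightarrow> 'a) \<Rightarrow> (real \<Rightarrow> 'a) \<Rightarrow> real \<Rightarrow> 'a" where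
  "join_paths \<gamma> \<delta> = (\<lambda>t. if t \<le> 1/2 then \<gamma> (2 * t) else \<delta> (2 * t - 1))"

lemma pathin_join_paths:
  assumes "pathin X \<gamma>" "pathin X \<delta>" "\<gamma> 1 = \<delta> 0"
  shows "pathin X (join_paths \<gamma> \<delta>)"
  unfolding pathin_def join_paths_def
proof (rule continuous_map_cases_le)
  have A: "continuous_map (subtopology (top_of_set {0..1}) {x \<in> topspace (top_of_set {0..1}). x \<le> 1/2})
      (top_of_set {0..1}) (\<lambda>t::real. 2 * t)"
    by (auto simp: continuous_map_in_subtopology subtopology_subtopology intro!: continuous_intros)
  show "continuous_map (subtopology (top_of_set {0..1}) {x \<in> topspace (top_of_set {0..1}). x \<le> 1/2})
      X (\<lambda>t. \<gamma> (2 * t))"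
    using continuous_map_compose[OF A assms(1)[unfolded pathin_def]] by (simp add: o_def)
  have B: "continuous_map (subtopology (top_of_set {0..1}) {x \<in> topspace (top_of_set {0..1}). 1/2 \<le> x})
      (top_of_set {0..1}) (\<lambda>t::real. 2 * t - 1)"
    by (auto simp: continuous_map_in_subtopology subtopology_subtopology intro!: continuous_intros)
  show "continuous_map (subtopology (top_of_set {0..1}) {x \<in> topspace (top_of_set {0..1}). 1/2 \<le> x})
      X (\<lambda>t. \<delta> (2 * t - 1))"
    using continuous_map_compose[OF B assms(2)[unfolded pathin_def]] by (simp add: o_def)
  show "\<gamma> (2 * t) = \<delta> (2 * t - 1)" if "t = 1/2" for t
    unfolding that using assms(3) by simp
qed auto

context double_cover
begin

lemma transport_join_paths:
  assumes "pathin X \<gamma>" "pathin X \<delta>" "\<gamma> 1 = \<delta> 0"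
  shows "transport (join_paths \<gamma> \<delta>) = (transport \<gamma> \<noteq> transport \<delta>)"
proof -
  have "continuous_map (top_of_set {0..1}) X (join_paths \<gamma> \<delta>)"
    using pathin_join_paths[OF assms] by (simp add: pathin_def)
  then obtain r where r: "lift_on (join_paths \<gamma> \<delta>) {0..1} r"
    by (rule lift_on_path_exists)
  have "lift_on (join_paths \<gamma> \<delta> \<circ> (\<lambda>t. t / 2)) {0..1} (r \<circ> (\<lambda>t. t / 2))"
    by (rule lift_on_compose[OF r]) (auto intro!: continuous_intros)
  then have "lift_on \<gamma> {0..1} (r \<circ> (\<lambda>t. t / 2))"
    by (rule lift_on_cong) (auto simp: join_paths_def)
  from transport_eq[OF this] have 1: "transport \<gamma> = (r 0 \<noteq> r (1/2))"
    by simp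
  have "lift_on (join_paths \<gamma> \<delta> \<circ> (\<lambda>t. (t + 1) / 2)) {0..1} (r \<circ> (\<lambda>t. (t + 1) / 2))"
    by (rule lift_on_compose[OF r]) (auto intro!: continuous_intros)
  then have "lift_on \<delta> {0..1} (r \<circ> (\<lambda>t. (t + 1) / 2))"
    by (rule lift_on_cong) (auto simp: join_paths_def assms(3) add_divide_distrib)
  from transport_eq[OF this] have 2: "transport \<delta> = (r (1/2) \<noteq> r 1)"
    by simp
  show ?thesis
    unfolding transport_eq[OF r] 1 2 by argo
qed

text \<open>The sum of the monodromies of the 1-simplices, extended linearly: a singular 1-cochain whose class modulo 2 is the
characteristic class of the double cover. Values in the free abelian group on one generator make \<open>frag_extend\<close>
provide the linearity.\<close>

definition crossing_number :: "'a chain \<Rightarrow> int" where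
  "crossing_number c =
     poly_mapping.lookup (frag_extend (\<lambda>\<sigma>. if transport (\<sigma> \<circ> edge) then frag_of () else 0) c) ()"

lemma crossing_number_add: "crossing_number (a + b) = crossing_number a + crossing_number b"
  by (simp add: crossing_number_def frag_extend_add lookup_add)

lemma crossing_number_diff: "crossing_number (a - b) = crossing_number a - crossing_number b"
  by (simp add: crossing_number_def frag_extend_diff lookup_minus)

lemma crossing_number_of: "crossing_number (frag_of \<sigma>) = of_bool (transport (\<sigma> \<circ> edge))"
  by (simp add: crossing_number_def)

text \<open>The crossing number is a cocycle modulo 2, because a double cover is trivial over a 2-simplex.\<close>

lemma even_crossing_number_boundary_simplex:
  assumes "singular_simplex 2 X \<sigma>"
  shows "even (crossing_number (chain_boundary 2 (frag_of \<sigma>)))"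
proof -
  define u where "u = \<sigma> \<circ> triangle"
  have u: "continuous_map (top_of_set ({0..1} \<times> {0..1})) X u"
    unfolding u_def
    using continuous_map_compose[OF continuous_triangle] assms by (auto simp: singular_simplex_def)
  have face: "transport (singular_face 2 k \<sigma> \<circ> edge) = transport (u \<circ> v)"
    if "\<And>t. t \<in> {0..1} \<Longrightarrow> simplical_face k (edge t) = triangle (v t)" "k \<le> 2" for k v
  proof (rule transport_cong)
    have "singular_simplex 1 X (singular_face 2 k \<sigma>)"
      using singular_simplex_singular_face[OF assms, of k] that by simp
    then show "continuous_map (top_of_set {0..1}) X (singular_face 2 k \<sigma> \<circ> edge)"
      using continuous_map_compose[OF continuous_edge] by (auto simp: singular_simplex_def)
    show "(singular_face 2 k \<sigma> \<circ> edge) t = (u \<circ> v) t" if "t \<in> {0..1}" for t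
      using that edge_in_simplex[OF that] \<open>\<And>t. t \<in> {0..1} \<Longrightarrow> _\<close>
      by (simp add: singular_face_def u_def)
  qed
  have f0: "transport (singular_face 2 0 \<sigma> \<circ> edge) = transport (\<lambda>t. u (1, t))"
  proof -
    have "simplical_face 0 (edge t) = triangle (1, t)" for t
      by (auto simp: fun_eq_iff simplical_face_def edge_def triangle_def)
    from face[OF this] show ?thesis by (simp add: o_def[of u])
  qed
  have f1: "transport (singular_face 2 1 \<sigma> \<circ> edge) = transport (\<lambda>t. u (t, 1))"
  proof -
    have "simplical_face 1 (edge t) = triangle (t, 1)" for t
      by (auto simp: fun_eq_iff simplical_face_def edge_def triangle_def)
    from face[OF this] show ?thesis by (simp add: o_def[of u])
  qed
  have f2: "transport (singular_face 2 2 \<sigma> \<circ> edge) = transport (\<lambda>t. u (t, 0))"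
  proof -
    have "simplical_face 2 (edge t) = triangle (t, 0)" for t
      by (auto simp: fun_eq_iff simplical_face_def edge_def triangle_def)
    from face[OF this] show ?thesis by (simp add: o_def[of u])
  qed
  have "triangle (0, t) = triangle (0, 0)" for t
    by (auto simp: triangle_def fun_eq_iff)
  then have "u (0, t) = u (0, 0)" for t
    unfolding u_def o_def by (rule arg_cong)
  then have "(\<lambda>t. u (0, t)) = (\<lambda>t. u (0, 0))"
    by (rule ext)
  moreover have "u (0, 0) \<in> topspace X"
    using continuous_map_image_subset_topspace[OF u] by (auto simp: image_subset_iff)
  ultimately have "\<not> transport (\<lambda>t. u (0, t))"
    using not_transport_const by metis
  with transport_square[OF u]
  have "(transport (singular_face 2 2 \<sigma> \<circ> edge) \<noteq> transport (singular_face 2 0 \<sigma> \<circ> edge))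
      = transport (singular_face 2 1 \<sigma> \<circ> edge)"
    unfolding f0 f1 f2 by argo
  moreover have "chain_boundary 2 (frag_of \<sigma>)
      = frag_of (singular_face 2 0 \<sigma>) - frag_of (singular_face 2 1 \<sigma>) + frag_of (singular_face 2 2 \<sigma>)"
    by (simp add: chain_boundary_of numeral_2_eq_2)
  ultimately show ?thesis
    by (auto simp: crossing_number_add crossing_number_diff crossing_number_of)
qed

lemma even_crossing_number_boundary:
  assumes "singular_chain 2 X d"
  shows "even (crossing_number (chain_boundary 2 d))"
  using assms unfolding singular_chain_def
proof (induction d rule: frag_induction)
  case zero
  then show ?case by (simp add: crossing_number_def)
next
  case (one \<sigma>)
  then show ?case using even_crossing_number_boundary_simplex by simp
next
  case (diff a b)
  then show ?case by (simp add: chain_boundary_diff crossing_number_diff)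
qed

text \<open>The difference of two paths with common ends is a 1-cycle.\<close>

lemma transport_path_independent:
  assumes "no_mod2_cohomology X" and \<gamma>: "pathin X \<gamma>" and \<delta>: "pathin X \<delta>"
    and ends: "\<gamma> 0 = \<delta> 0" "\<gamma> 1 = \<delta> 1"
  shows "transport \<gamma> = transport \<delta>"
proof -
  define as_simplex where "as_simplex = (\<lambda>\<gamma>::real \<Rightarrow> 'a. restrict (\<lambda>x::nat \<Rightarrow> real. \<gamma> (x 1)) (standard_simplex 1))"
  have simplex: "singular_simplex 1 X (as_simplex \<gamma>)" if "pathin X \<gamma>" for \<gamma>
  proof -
    have "continuous_map (subtopology (powertop_real UNIV) (standard_simplex 1)) (top_of_set {0..1})
        (\<lambda>x. x 1)"
      by (auto simp: continuous_map_in_subtopology standard_simplex_def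
          intro!: continuous_map_from_subtopology continuous_map_product_projection)
    from continuous_map_compose[OF this] that
    have "continuous_map (subtopology (powertop_real UNIV) (standard_simplex 1)) X (\<lambda>x. \<gamma> (x 1))"
      unfolding pathin_def o_def by blast
    then have "continuous_map (subtopology (powertop_real UNIV) (standard_simplex 1)) X (as_simplex \<gamma>)"
      by (rule continuous_map_eq) (simp add: as_simplex_def)
    then show ?thesis
      by (simp add: singular_simplex_def as_simplex_def)
  qed
  have transport_simplex: "transport (as_simplex \<gamma> \<circ> edge) = transport \<gamma>" if "pathin X \<gamma>" for \<gamma>
  proof (rule transport_cong[symmetric])
    show "\<gamma> t = (as_simplex \<gamma> \<circ> edge) t" if "t \<in> {0..1}" for t
      using edge_in_simplex[OF that] by (simp add: as_simplex_def edge_def)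
  qed (use that in \<open>simp add: pathin_def\<close>)
  have face: "singular_face 1 0 (as_simplex \<gamma>) = restrict (\<lambda>x. \<gamma> 1) (standard_simplex 0)"
    "singular_face 1 1 (as_simplex \<gamma>) = restrict (\<lambda>x. \<gamma> 0) (standard_simplex 0)" for \<gamma>
  proof -
    have *: "simplical_face k x \<in> standard_simplex 1" if "x \<in> standard_simplex 0" "k \<le> 1" for k and x :: "nat \<Rightarrow> real"
      using simplical_face_in_standard_simplex[of 1 k x] that by simp
    show "singular_face 1 0 (as_simplex \<gamma>) = restrict (\<lambda>x. \<gamma> 1) (standard_simplex 0)"
      "singular_face 1 1 (as_simplex \<gamma>) = restrict (\<lambda>x. \<gamma> 0) (standard_simplex 0)"
      using *[of _ 0] *[of _ 1] unfolding singular_face_def as_simplex_def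
      by (auto intro!: restrict_ext) (auto simp: simplical_face_def standard_simplex_0)
  qed
  have "singular_relcycle 1 X {} (frag_of (as_simplex \<gamma>) - frag_of (as_simplex \<delta>))"
    unfolding singular_cycle
    using simplex[OF \<gamma>] simplex[OF \<delta>] ends
    by (simp add: singular_chain_diff singular_chain_of chain_boundary_diff chain_boundary_of
        face[unfolded One_nat_def])
  from even_on_cycles[OF assms(1) crossing_number_add even_crossing_number_boundary this] show ?thesis
    using transport_simplex[OF \<gamma>] transport_simplex[OF \<delta>]
    by (auto simp: crossing_number_diff crossing_number_of split: if_splits)
qed

text \<open>A principal \<open>\<int>/2\<close>-bundle over a space without first cohomology modulo 2 is trivial. The section \<open>F\<close> is
obtained by transporting a germ from a base point along paths.\<close>

lemma global_section_exists:
  assumes trivial: "no_mod2_cohomology X"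
    and pc: "path_connected_space X" and lpc: "locally_path_connected_space X"
  obtains F where "\<And>x. x \<in> topspace X \<Longrightarrow> \<exists>k. agrees x F (\<lambda>w. k \<noteq> f x w)"
proof (cases "topspace X = {}")
  case True
  then show ?thesis using that by blast
next
  case False
  then obtain b where b: "b \<in> topspace X" by blast
  define sheet where "sheet = (\<lambda>x. transport (SOME \<gamma>. pathin X \<gamma> \<and> \<gamma> 0 = b \<and> \<gamma> 1 = x))"
  have path: "\<exists>\<gamma>. pathin X \<gamma> \<and> \<gamma> 0 = b \<and> \<gamma> 1 = x" if "x \<in> topspace X" for x
    using pc b that unfolding path_connected_space_def by blast
  have sheet: "sheet x = transport \<gamma>" if "pathin X \<gamma>" "\<gamma> 0 = b" "\<gamma> 1 = x" for \<gamma> x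
  proof -
    have "\<exists>\<gamma>. pathin X \<gamma> \<and> \<gamma> 0 = b \<and> \<gamma> 1 = x"
      using that by blast
    from someI_ex[OF this] show ?thesis
      unfolding sheet_def using that by (intro transport_path_independent[OF trivial]) auto
  qed
  \<comment> \<open>The value at \<open>w\<close> of the germ over \<open>w\<close>; off \<open>Y\<close> a germ determines this value.\<close>
  define F where "F = (\<lambda>w. sheet w \<noteq> f w w)"
  have "agrees p F (\<lambda>w. sheet p \<noteq> f p w)" if p: "p \<in> topspace X" for p
  proof -
    obtain N where N: "openin X N" "p \<in> N"
      "\<And>z. z \<in> N \<Longrightarrow> agrees z (f p) (\<lambda>w. transition p z \<noteq> f z w)"
      using transition_nbhd[OF p] by metis
    obtain V where V: "openin X V" "path_connectedin X V" "p \<in> V" "V \<subseteq> N"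
      using lpc N(1,2) unfolding locally_path_connected_space by metis
    have value_eq: "f p w = (transition p w \<noteq> f w w)" if "w \<in> N" "w \<notin> Y" for w
      using N(3)[OF that(1)] that(2) unfolding agree_near_def by (metis DiffI)
    \<comment> \<open>By density, a function and its negation have different germs.\<close>
    have no_jump: "\<not> transition p p"
    proof -
      obtain M where M: "openin X M" "p \<in> M" "\<forall>w\<in>M - Y. f p w = (transition p p \<noteq> f p w)"
        using N(3)[OF N(2)] unfolding agree_near_def by metis
      obtain w where "w \<in> M" "w \<notin> Y"
        using dense[OF M(1,2)] by metis
      then show ?thesis using M(3) by blast
    qed
    have sheet_eq: "sheet q = (sheet p \<noteq> transition p q)" if q: "q \<in> V" for q
    proof -
      obtain \<gamma> where \<gamma>: "pathin X \<gamma>" "\<gamma> 0 = b" "\<gamma> 1 = p"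
        using path[OF p] by metis
      obtain \<delta> where \<delta>: "pathin X \<delta>" "\<delta> ` {0..1} \<subseteq> V" "\<delta> 0 = p" "\<delta> 1 = q"
        using V(2,3) q unfolding path_connectedin by (metis image_subset_iff_funcset)
      have "lift_on \<delta> {0..1} (\<lambda>t. transition p (\<delta> t))"
        by (rule lift_on_transition[OF N(1,3)]) (use \<delta> V(4) in \<open>auto simp: pathin_def\<close>)
      from transport_eq[OF this] have "transport \<delta> = transition p q"
        using \<delta> no_jump by simp
      moreover have "sheet q = transport (join_paths \<gamma> \<delta>)"
        by (rule sheet) (use \<gamma> \<delta> pathin_join_paths[OF \<gamma>(1) \<delta>(1)] in \<open>auto simp: join_paths_def\<close>)
      moreover have "sheet p = transport \<gamma>"
        by (rule sheet) (use \<gamma> in auto)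
      ultimately show ?thesis
        using transport_join_paths \<gamma> \<delta> by simp
    qed
    show ?thesis
    proof (rule agree_nearI[OF V(1,3)])
      fix w assume "w \<in> V" "w \<notin> Y"
      then show "F w = (sheet p \<noteq> f p w)"
        using sheet_eq[of w] value_eq[of w] V(4) unfolding F_def by auto
    qed
  qed
  then show thesis
    using that by metis
qed

end

section \<open>Graphs that are closed hypersurfaces in Euclidean space\<close>

lemma Euclidean_space_eq_top_of_set: "Euclidean_space n = top_of_set {x. \<forall>i\<ge>n. x i = 0}"
  by (simp add: Euclidean_space_def euclidean_product_topology)

lemma connectedin_Euclidean_space_iff:
  "connectedin (Euclidean_space n) S \<longleftrightarrow> S \<subseteq> topspace (Euclidean_space n) \<and> connected S"
  by (auto simp: Euclidean_space_eq_top_of_set connectedin_subtopology connectedin_iff_connected)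

lemma connected_attach:
  assumes "connected A" "A \<subseteq> B"
    and "\<And>x. x \<in> B \<Longrightarrow> \<exists>C. connected C \<and> x \<in> C \<and> C \<subseteq> B \<and> C \<inter> A \<noteq> {}"
  shows "connected B"
proof (cases "B = {}")
  case False
  obtain C where C: "\<And>x. x \<in> B \<Longrightarrow> connected (C x) \<and> x \<in> C x \<and> C x \<subseteq> B \<and> C x \<inter> A \<noteq> {}"
    using assms(3) by metis
  have "connected (\<Union>x\<in>B. A \<union> C x)"
  proof (rule connected_Union)
    show "connected s" if "s \<in> (\<lambda>x. A \<union> C x) ` B" for s
      using that C \<open>connected A\<close> by (auto intro!: connected_Un)
    show "\<Inter> ((\<lambda>x. A \<union> C x) ` B) \<noteq> {}"
      using C False by blast
  qed
  moreover have "(\<Union>x\<in>B. A \<union> C x) = B"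
    using C \<open>A \<subseteq> B\<close> by blast
  ultimately show ?thesis by simp
qed simp

lemma connected_components_of_two:
  assumes "openin Z A" "openin Z B" "A \<union> B = topspace Z" "A \<inter> B = {}"
    and "connectedin Z A" "connectedin Z B" "A \<noteq> {}" "B \<noteq> {}"
  shows "connected_components_of Z = {A, B}"
proof -
  have *: "connected_component_of_set Z x = A"
    if AB: "openin Z A" "openin Z B" "A \<union> B = topspace Z" "A \<inter> B = {}" "connectedin Z A" "x \<in> A"
    for A B x
  proof
    show "A \<subseteq> connected_component_of_set Z x"
      using AB by (intro connected_component_of_maximal) auto
    have "connectedin Z (connected_component_of_set Z x)"
      by (rule connectedin_connected_component_of)
    moreover have "x \<in> connected_component_of_set Z x"
      using AB by (auto simp: connected_component_of_refl)
    moreover have "connected_component_of_set Z x \<subseteq> A \<union> B"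
      using connected_component_of_subset_topspace AB(3) by metis
    ultimately show "connected_component_of_set Z x \<subseteq> A"
      using AB connectedinD[of Z "connected_component_of_set Z x" A B] by blast
  qed
  have "connected_components_of Z = connected_component_of_set Z ` (A \<union> B)"
    using assms(3) by (simp add: connected_components_of_def)
  also have "\<dots> = {A} \<union> {B}"
  proof -
    have "connected_component_of_set Z ` A = {A}"
      using *[OF assms(1-5)] \<open>A \<noteq> {}\<close> by auto
    moreover have "connected_component_of_set Z ` B = {B}"
      using *[of B A] assms by auto
    ultimately show ?thesis by (simp add: image_Un)
  qed
  finally show ?thesis by auto
qed

text \<open>A model of a closed hypersurface in \<open>\<real>\<^bsup>m+1\<^esup>\<close> that is homeomorphic to an arbitrary connected open
set \<open>U\<close> of \<open>\<real>\<^sup>m\<close>: the graph of \<open>1 / d\<close>, where \<open>d\<close> vanishes outside \<open>U\<close>. The graph is closed,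
since the function tends to infinity towards the frontier of \<open>U\<close>. Writing its equation as \<open>d p * t = 1\<close> keeps
everything continuous on the whole space.\<close>

locale steep_graph =
  fixes m :: nat and U :: "(nat \<Rightarrow> real) set" and d :: "(nat \<Rightarrow> real) \<Rightarrow> real"
  assumes U_sub: "U \<subseteq> topspace (Euclidean_space m)" and U_ne: "U \<noteq> {}" and U_conn: "connected U"
    and cont_d: "continuous_on UNIV d" and d_nonneg: "\<And>x. d x \<ge> 0"
    and d_pos: "\<And>x. x \<in> topspace (Euclidean_space m) \<Longrightarrow> x \<in> U \<longleftrightarrow> d x > 0"
begin

abbreviation E :: "(nat \<Rightarrow> real) set" where "E \<equiv> topspace (Euclidean_space (Suc m))"

definition height :: "(nat \<Rightarrow> real) \<Rightarrow> real" where
  "height x = d (x(m := 0)) * x m"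

definition graph_over :: "(nat \<Rightarrow> real) set \<Rightarrow> (nat \<Rightarrow> real) set" where
  "graph_over S = {x \<in> E. x(m := 0) \<in> S \<and> height x = 1}"

definition upper_side :: "(nat \<Rightarrow> real) set" where "upper_side = {x \<in> E. height x > 1}"
definition lower_side :: "(nat \<Rightarrow> real) set" where "lower_side = {x \<in> E. height x < 1}"

lemma continuous_upd: "continuous_on S f \<Longrightarrow> continuous_on S g \<Longrightarrow> continuous_on S (\<lambda>x. (f x)(m := g x))"
  for f :: "'b::topological_space \<Rightarrow> nat \<Rightarrow> real"
proof (rule continuous_on_coordinatewise_then_product)
  fix i assume "continuous_on S f" "continuous_on S g"
  then show "continuous_on S (\<lambda>x. ((f x)(m := g x)) i)"
    by (cases "i = m") (auto intro: continuous_on_product_then_coordinatewise)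
qed

lemma continuous_height: "continuous_on UNIV height"
proof -
  have "continuous_on UNIV (\<lambda>x::nat \<Rightarrow> real. x(m := 0))"
    by (intro continuous_upd continuous_intros)
  then have "continuous_on UNIV (\<lambda>x. d (x(m := 0)))"
    using continuous_on_compose2[OF cont_d] by auto
  then show ?thesis
    unfolding height_def by (intro continuous_intros) auto
qed

lemma upd_in_E [simp]: "x(m := t) \<in> E \<longleftrightarrow> x \<in> E"
  by (auto simp: topspace_Euclidean_space)

lemma height_upd [simp]: "height (x(m := t)) = d (x(m := 0)) * t"
  by (simp add: height_def)

lemma proj_in: "x \<in> E \<Longrightarrow> x(m := 0) \<in> topspace (Euclidean_space m)"
  by (auto simp: topspace_Euclidean_space intro: Suc_leI le_neq_implies_less)

lemma sub_E: "x \<in> topspace (Euclidean_space m) \<Longrightarrow> x \<in> E"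
  by (auto simp: topspace_Euclidean_space)

lemma upd_zero: "x \<in> topspace (Euclidean_space m) \<Longrightarrow> x(m := 0) = x"
  by (auto simp: topspace_Euclidean_space)

lemma connected_line: "connected S \<Longrightarrow> connected ((\<lambda>t. x(m := t)) ` S)"
  for x :: "nat \<Rightarrow> real"
  using continuous_upd[of S "\<lambda>_. x" "\<lambda>t. t"]
  by (intro connected_continuous_image) (auto intro: continuous_on_const continuous_on_id)

text \<open>The upper side fibres over \<open>U\<close> with half-lines as fibres.\<close>

lemma connected_upper_side: "connected upper_side"
proof -
  have "connected ((\<lambda>(p, s). p(m := s / d p)) ` (U \<times> {1<..}))"
  proof (rule connected_continuous_image)
    have "continuous_on (U \<times> {1<..}) (\<lambda>x. d (fst x))"
      by (rule continuous_on_compose2[OF cont_d]) (auto intro: continuous_intros)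
    moreover have "d (fst x) \<noteq> 0" if "x \<in> U \<times> {1<..}" for x :: "_ \<times> real"
      using d_pos U_sub that by (metis less_irrefl mem_Times_iff subsetD)
    ultimately show "continuous_on (U \<times> {1<..}) (\<lambda>(p, s). p(m := s / d p))"
      unfolding case_prod_unfold by (intro continuous_upd continuous_intros) auto
  qed (intro connected_Times U_conn, auto)
  moreover have "(\<lambda>(p, s). p(m := s / d p)) ` (U \<times> {1<..}) = upper_side"
  proof (intro subset_antisym subsetI)
    fix x assume "x \<in> (\<lambda>(p, s). p(m := s / d p)) ` (U \<times> {1<..})"
    then obtain p s where x: "x = p(m := s / d p)" "p \<in> U" "s > 1"
      by auto
    then have "d p > 0" "p \<in> topspace (Euclidean_space m)" using d_pos U_sub by auto
    then show "x \<in> upper_side"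
      using x by (simp add: upper_side_def upd_zero sub_E)
  next
    fix x assume x: "x \<in> upper_side"
    then have "d (x(m := 0)) \<noteq> 0"
      by (auto simp: upper_side_def height_def)
    then have "d (x(m := 0)) > 0"
      using d_nonneg[of "x(m := 0)"] by linarith
    moreover have "x(m := 0) \<in> topspace (Euclidean_space m)"
      using x proj_in by (auto simp: upper_side_def)
    ultimately have "x(m := 0) \<in> U" using d_pos by blast
    moreover have "x = (x(m := 0))(m := height x / d (x(m := 0)))"
      using \<open>d (x(m := 0)) > 0\<close> by (auto simp: height_def)
    ultimately show "x \<in> (\<lambda>(p, s). p(m := s / d p)) ` (U \<times> {1<..})"
      using x by (auto simp: upper_side_def intro!: image_eqI[of _ _ "(x(m := 0), height x)"])
  qed
  ultimately show ?thesis by simp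
qed

text \<open>From every point of the lower side one can move vertically to the hyperplane where the last coordinate is \<open>-1\<close>,
since \<open>d\<close> is nonnegative.\<close>

lemma connected_lower_side: "connected lower_side"
proof (rule connected_attach)
  let ?P = "(\<lambda>x. x(m := - 1)) ` topspace (Euclidean_space m)"
  have "connected (topspace (Euclidean_space m))"
    using connected_Euclidean_space[of m] by (metis connectedin_Euclidean_space_iff connectedin_topspace)
  then show "connected ?P"
    by (rule connected_continuous_image[rotated]) (intro continuous_upd continuous_intros)
  show "?P \<subseteq> lower_side"
  proof clarify
    fix p assume p: "p \<in> topspace (Euclidean_space m)"
    then have "height (p(m := -1)) < 1" using d_nonneg[of "p(m:=0)"] by simp
    then show "p(m := -1) \<in> lower_side"
      using p sub_E by (simp add: lower_side_def)
  qed
  fix x assume x: "x \<in> lower_side"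
  let ?L = "(\<lambda>t. x(m := t)) ` {min (-1) (x m)..max (-1) (x m)}"
  show "\<exists>C. connected C \<and> x \<in> C \<and> C \<subseteq> lower_side \<and> C \<inter> ?P \<noteq> {}"
  proof (intro exI conjI)
    show "connected ?L" by (rule connected_line) simp
    show "x \<in> ?L" by (rule image_eqI[of _ _ "x m"]) auto
    show "?L \<subseteq> lower_side"
    proof clarify
      fix t assume t: "t \<in> {min (-1) (x m)..max (-1) (x m)}"
      have "d (x(m := 0)) * t \<le> d (x(m := 0)) * max (-1) (x m)"
        using t d_nonneg by (intro mult_left_mono) auto
      also have "\<dots> < 1"
        using x d_nonneg[of "x(m := 0)"] by (auto simp: lower_side_def height_def max_def)
      finally show "x(m := t) \<in> lower_side"
        using x by (simp add: lower_side_def)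
    qed
    have "x(m := -1) \<in> ?L" by auto
    moreover have "x(m := -1) = (x(m := 0))(m := -1)" by simp
    moreover have "x(m := 0) \<in> topspace (Euclidean_space m)" using x proj_in by (auto simp: lower_side_def)
    ultimately show "?L \<inter> ?P \<noteq> {}" by (metis IntI empty_iff image_eqI)
  qed
qed

lemma upper_side_ne: "upper_side \<noteq> {}"
proof -
  obtain p where p: "p \<in> U" using U_ne by blast
  then have "d p > 0" "p \<in> topspace (Euclidean_space m)" using d_pos U_sub by auto
  then have "p(m := 2 / d p) \<in> upper_side" by (simp add: upper_side_def sub_E upd_zero)
  then show ?thesis by blast
qed

lemma lower_side_ne: "lower_side \<noteq> {}"
proof -
  have "(\<lambda>i. 0) \<in> lower_side" by (auto simp: lower_side_def height_def topspace_Euclidean_space)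
  then show ?thesis by blast
qed

lemma height_one_imp: 
  assumes "x \<in> E" "height x = 1" shows "x(m := 0) \<in> U"
proof -
  have "d (x(m := 0)) \<noteq> 0" using assms by (auto simp: height_def)
  then have "d (x(m := 0)) > 0" using d_nonneg[of "x(m := 0)"] by linarith
  then show ?thesis using assms d_pos proj_in by blast
qed

lemma open_sides:
  "openin (Euclidean_space (Suc m)) upper_side" "openin (Euclidean_space (Suc m)) lower_side"
proof -
  have "open {x. height x > 1}" "open {x. height x < 1}"
    by (intro open_Collect_less continuous_height continuous_intros)+
  then have "openin (top_of_set E) (E \<inter> {x. height x > 1})" "openin (top_of_set E) (E \<inter> {x. height x < 1})"
    by (auto intro: openin_open_Int)
  then show "openin (Euclidean_space (Suc m)) upper_side" "openin (Euclidean_space (Suc m)) lower_side"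
    unfolding Euclidean_space_eq_top_of_set topspace_euclidean_subtopology
    by (simp_all add: upper_side_def lower_side_def Euclidean_space_eq_top_of_set Int_def)
qed

lemma components_graph_complement:
  "connected_components_of (subtopology (Euclidean_space (Suc m)) (E - graph_over U)) = {upper_side, lower_side}"
proof (rule connected_components_of_two)
  have un: "upper_side \<union> lower_side = E - graph_over U"
    using height_one_imp by (auto simp: upper_side_def lower_side_def graph_over_def)
  then show "upper_side \<union> lower_side = topspace (subtopology (Euclidean_space (Suc m)) (E - graph_over U))"
    by auto
  show "upper_side \<inter> lower_side = {}" by (auto simp: upper_side_def lower_side_def)
  show "openin (subtopology (Euclidean_space (Suc m)) (E - graph_over U)) upper_side"
    "openin (subtopology (Euclidean_space (Suc m)) (E - graph_over U)) lower_side"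
    using open_sides un by (auto intro: openin_subset_topspace_eq simp: openin_subtopology_Int2 openin_subtopology_alt)
  show "connectedin (subtopology (Euclidean_space (Suc m)) (E - graph_over U)) upper_side"
    "connectedin (subtopology (Euclidean_space (Suc m)) (E - graph_over U)) lower_side"
    using un connected_upper_side connected_lower_side
    by (auto simp: connectedin_subtopology connectedin_Euclidean_space_iff)
qed (use upper_side_ne lower_side_ne in auto)

text \<open>A vertical line over a point of \<open>U - S\<close> misses the graph over \<open>S\<close> and joins the two sides.\<close>

lemma connected_graph_complement:
  assumes "S \<subseteq> U" "S \<noteq> U"
  shows "connected (E - graph_over S)"
proof -
  obtain p where p: "p \<in> U" "p \<notin> S" using assms by blast
  have dp: "d p > 0" "p \<in> topspace (Euclidean_space m)" using d_pos U_sub p by auto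
  let ?L = "\<lambda>x :: nat \<Rightarrow> real. range (\<lambda>t. x(m := t))"
  have L: "connected (?L x)" for x using connected_line[OF connected_UNIV, of x] by simp
  have L_sub: "?L x \<subseteq> E - graph_over S" if "x \<in> E" "x(m := 0) \<notin> S" for x
    using that by (auto simp: graph_over_def)
  have L_lower: "?L x \<inter> lower_side \<noteq> {}" if "x \<in> E" for x
  proof -
    have "x(m := 0) \<in> ?L x \<inter> lower_side" using that by (auto simp: lower_side_def)
    then show ?thesis by blast
  qed
  have "p(m := 2 / d p) \<in> ?L p \<inter> upper_side" using dp by (auto simp: upper_side_def sub_E upd_zero)
  then have LU: "connected (?L p \<union> upper_side)"
    by (intro connected_Un L connected_upper_side) auto
  have A: "connected (lower_side \<union> (?L p \<union> upper_side))"
    by (rule connected_Un[OF connected_lower_side LU]) (use L_lower[of p] dp sub_E in blast)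
  show ?thesis
  proof (rule connected_attach[OF A])
    show "lower_side \<union> (?L p \<union> upper_side) \<subseteq> E - graph_over S"
      using L_sub[of p] dp p by (auto simp: sub_E upd_zero lower_side_def upper_side_def graph_over_def)
    fix x assume x: "x \<in> E - graph_over S"
    show "\<exists>C. connected C \<and> x \<in> C \<and> C \<subseteq> E - graph_over S \<and> C \<inter> (lower_side \<union> (?L p \<union> upper_side)) \<noteq> {}"
    proof (cases "height x = 1")
      case True
      then have "x(m := 0) \<notin> S" using x by (auto simp: graph_over_def)
      then show ?thesis
        using x L[of x] L_sub[of x] L_lower[of x]
        by (intro exI[of _ "?L x"]) (auto intro: range_eqI[of _ _ "x m"])
    next
      case False
      then have "x \<in> upper_side \<or> x \<in> lower_side" using x by (auto simp: upper_side_def lower_side_def)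
      then show ?thesis using x by (intro exI[of _ "{x}"]) auto
    qed
  qed
qed

lemma graph_over_closed:
  assumes "closedin (subtopology (Euclidean_space m) U) S"
  shows "closedin (Euclidean_space (Suc m)) (graph_over S)"
proof -
  obtain C where C: "closedin (Euclidean_space m) C" "S = C \<inter> U"
    using assms by (auto simp: closedin_subtopology)
  then have clC: "closed C" by (simp add: closedin_Euclidean_space_iff)
  have "closed ((\<lambda>x. x(m := 0)) -` C)"
    by (rule closed_vimage[OF clC]) (intro continuous_upd continuous_intros)
  moreover have "closed {x. height x = 1}"
    by (intro closed_Collect_eq continuous_height continuous_intros)
  moreover have "closed E" by (metis closedin_Euclidean_imp_closed closedin_topspace)
  ultimately have "closed (E \<inter> (\<lambda>x. x(m := 0)) -` C \<inter> {x. height x = 1})"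
    by (intro closed_Int)
  moreover have "graph_over S = E \<inter> (\<lambda>x. x(m := 0)) -` C \<inter> {x. height x = 1}"
    using height_one_imp C by (auto simp: graph_over_def)
  ultimately show ?thesis by (auto simp: closedin_Euclidean_space_iff)
qed

lemma graph_over_homeomorphic:
  assumes "S \<subseteq> U"
  shows "subtopology (Euclidean_space m) S homeomorphic_space subtopology (Euclidean_space (Suc m)) (graph_over S)"
  unfolding homeomorphic_space_def homeomorphic_maps_def
proof (intro exI conjI ballI)
  have S: "S \<subseteq> topspace (Euclidean_space m)" using assms U_sub by blast
  have G: "graph_over S \<subseteq> E" by (auto simp: graph_over_def)
  have d: "d x > 0" if "x \<in> S" for x using that assms d_pos U_sub by blast
  have "continuous_on S d" using cont_d continuous_on_subset by blast
  then have c: "continuous_on S (\<lambda>x. x(m := 1 / d x))"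
    using d by (intro continuous_upd continuous_intros) (auto simp: less_imp_neq[symmetric])
  have into: "x(m := 1 / d x) \<in> graph_over S" if "x \<in> S" for x
  proof -
    have "x \<in> topspace (Euclidean_space m)" using that S by blast
    then show ?thesis using d[OF that] that by (simp add: graph_over_def sub_E upd_zero)
  qed
  show "continuous_map (subtopology (Euclidean_space m) S)
      (subtopology (Euclidean_space (Suc m)) (graph_over S)) (\<lambda>x. x(m := 1 / d x))"
    using c into G S
    by (auto simp: continuous_map_in_subtopology cm_Euclidean_space_iff_continuous_on Int_absorb1)
  have c': "continuous_on (graph_over S) (\<lambda>x::nat \<Rightarrow> real. x(m := 0))"
    by (intro continuous_upd continuous_intros)
  show "continuous_map (subtopology (Euclidean_space (Suc m)) (graph_over S))
      (subtopology (Euclidean_space m) S) (\<lambda>x. x(m := 0))"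
    using c' G S
    by (auto simp: continuous_map_in_subtopology cm_Euclidean_space_iff_continuous_on Int_absorb1 proj_in graph_over_def)
  show "(x(m := 1 / d x))(m := 0) = x" if "x \<in> topspace (subtopology (Euclidean_space m) S)" for x
    using that by (simp add: upd_zero)
  show "(x(m := 0))(m := 1 / d (x(m := 0))) = x"
    if "x \<in> topspace (subtopology (Euclidean_space (Suc m)) (graph_over S))" for x
  proof -
    have "d (x(m := 0)) * x m = 1" using that by (auto simp: graph_over_def height_def)
    then have "1 / d (x(m := 0)) = x m" by (metis nonzero_mult_div_cancel_left mult_zero_left zero_neq_one)
    then show ?thesis by simp
  qed
qed

end

lemma steep_graph_exists:
  assumes "openin (Euclidean_space m) U" "connected U" "U \<noteq> {}"
  obtains d where "steep_graph m U d"
proof -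
  let ?C = "topspace (Euclidean_space m) - U"
  have C: "closed ?C" using assms(1) by (metis closedin_Euclidean_imp_closed closedin_def openin_closedin_eq)
  have sub: "U \<subseteq> topspace (Euclidean_space m)" using assms(1) openin_subset by blast
  \<comment> \<open>The distance to the empty set is zero by convention, hence the case distinction.\<close>
  define d where "d = (\<lambda>x. if ?C = {} then 1 else infdist x ?C)"
  have "steep_graph m U d"
  proof
    show "continuous_on UNIV d" unfolding d_def by (cases "?C = {}") (auto intro!: continuous_intros)
    show "d x \<ge> 0" for x by (simp add: d_def infdist_nonneg)
    show "x \<in> U \<longleftrightarrow> d x > 0" if "x \<in> topspace (Euclidean_space m)" for x
      using that in_closed_iff_infdist_zero[OF C, of x] infdist_nonneg[of x ?C] sub
      by (auto simp: d_def less_le)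
  qed (use assms sub in auto)
  then show thesis using that by blast
qed

section \<open>Closed hypersurfaces in Euclidean space have two sides\<close>

text \<open>The complements of homeomorphic closed subsets of \<open>\<real>\<^bsup>m+1\<^esup>\<close> have equally many components, however wildly the
subsets are embedded. Comparison with the steep graph over \<open>U\<close> gives two components for the complement of \<open>S\<close>,
and comparison with the graph over a proper closed part of \<open>U\<close> shows that no proper closed part of \<open>S\<close>
separates. If a point of \<open>S\<close> were away from the closure of one side, then the part of \<open>S\<close> in this closure
would separate.\<close>

lemma closed_hypersurface_sides:
  assumes S: "closedin (Euclidean_space (Suc m)) S"
    and U: "openin (Euclidean_space m) U" "connected U" "U \<noteq> {}"
    and hom: "subtopology (Euclidean_space (Suc m)) S homeomorphic_space subtopology (Euclidean_space m) U"
  obtains A B where "openin (Euclidean_space (Suc m)) A" "openin (Euclidean_space (Suc m)) B"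
    "A \<union> B = topspace (Euclidean_space (Suc m)) - S" "A \<inter> B = {}"
    "connectedin (Euclidean_space (Suc m)) A" "connectedin (Euclidean_space (Suc m)) B"
    "S \<subseteq> Euclidean_space (Suc m) closure_of A" "S \<subseteq> Euclidean_space (Suc m) closure_of B"
proof -
  let ?X = "Euclidean_space (Suc m)" and ?Y = "Euclidean_space m"
  obtain d where "steep_graph m U d" using steep_graph_exists[OF U] .
  then interpret steep_graph m U d .
  have S_sub: "S \<subseteq> topspace ?X" using S closedin_subset by blast
  let ?C = "connected_components_of (subtopology ?X (E - S))"
  have "?C \<approx> connected_components_of (subtopology ?X (E - graph_over U))"
  proof (rule eqpoll_connected_components_Euclidean_complements[OF S])
    show "closedin ?X (graph_over U)"
      by (rule graph_over_closed) (metis closedin_topspace inf.absorb2 U_sub topspace_subtopology)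
    show "subtopology ?X S homeomorphic_space subtopology ?X (graph_over U)"
      using hom graph_over_homeomorphic homeomorphic_space_trans by blast
  qed
  moreover have "upper_side \<noteq> lower_side"
    using upper_side_ne by (auto simp: upper_side_def lower_side_def)
  then have "card {upper_side, lower_side} = 2" by simp
  ultimately have "card ?C = 2"
    unfolding components_graph_complement using eqpoll_finite_iff eqpoll_iff_card
    by (metis finite.emptyI finite_insert)
  then obtain A B where AB: "?C = {A, B}" "A \<noteq> B"
    by (meson card_2_iff)
  then have AB_in: "A \<in> ?C" "B \<in> ?C" by auto
  have un: "A \<union> B = E - S"
    using Union_connected_components_of[of "subtopology ?X (E - S)"] AB by auto
  have disj: "A \<inter> B = {}"
    using pairwise_disjoint_connected_components_of[of "subtopology ?X (E - S)"] AB
    by (auto simp: pairwise_def disjnt_def)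
  have ne: "A \<noteq> {}" "B \<noteq> {}" using AB_in nonempty_connected_components_of by blast+
  have conn: "connectedin ?X A" "connectedin ?X B"
    using AB_in connectedin_connected_components_of connectedin_subtopology by blast+
  have "locally_connected_space ?X"
    by (simp add: locally_path_connected_Euclidean_space locally_path_connected_imp_locally_connected_space)
  moreover have "openin ?X (E - S)" using S by blast
  ultimately have opn: "openin ?X A" "openin ?X B"
    using AB_in locally_connected_space_open_connected_components by blast+
  \<comment> \<open>Deleting a relatively open piece of \<open>S\<close> opens a passage between the two sides.\<close>
  have no_sep: "connected (E - S2)" if S2: "closedin ?X S2" "S2 \<subseteq> S" "S2 \<noteq> S" for S2
  proof -
    obtain \<phi> where \<phi>: "homeomorphic_map (subtopology ?X S) (subtopology ?Y U) \<phi>"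
      using hom homeomorphic_space by blast
    have top: "topspace (subtopology ?X S) = S" "topspace (subtopology ?Y U) = U"
      using S_sub U_sub by auto
    have img: "\<phi> ` S = U" and inj: "inj_on \<phi> S"
      using \<phi> homeomorphic_imp_surjective_map homeomorphic_imp_injective_map top by metis+
    have sub: "\<phi> ` S2 \<subseteq> U" "\<phi> ` S2 \<noteq> U"
      using img inj S2 by (auto simp: inj_on_image_eq_iff)
    have "closedin (subtopology ?X S) S2" using S2 by (metis closedin_subset_topspace)
    then have cl: "closedin (subtopology ?Y U) (\<phi> ` S2)"
      using \<phi> homeomorphic_map_closedness_eq by blast
    have "homeomorphic_map (subtopology (subtopology ?X S) S2) (subtopology (subtopology ?Y U) (\<phi> ` S2)) \<phi>"
      by (rule homeomorphic_map_subtopologies[OF \<phi>]) (use top S2 sub in auto)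
    then have "subtopology ?X S2 homeomorphic_space subtopology ?Y (\<phi> ` S2)"
      using S2 sub homeomorphic_map_imp_homeomorphic_space
      by (simp add: subtopology_subtopology inf.absorb2)
    then have "subtopology ?X S2 homeomorphic_space subtopology ?X (graph_over (\<phi> ` S2))"
      using graph_over_homeomorphic[OF sub(1)] homeomorphic_space_trans by blast
    from connected_in_Euclidean_complements[OF S2(1) graph_over_closed[OF cl] this]
      connected_graph_complement[OF sub]
    show ?thesis by (auto simp: connectedin_Euclidean_space_iff)
  qed
  have closure: "S \<subseteq> ?X closure_of B"
    if AB: "A \<union> B = E - S" "A \<inter> B = {}" "openin ?X A" "openin ?X B" "A \<noteq> {}" "B \<noteq> {}" for A B
  proof (rule ccontr)
    assume not: "\<not> S \<subseteq> ?X closure_of B"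
    define K where "K = ?X closure_of B"
    have K: "closedin ?X K" "B \<subseteq> K" "K \<inter> A = {}" "K \<subseteq> E"
      using AB openin_Int_closure_of_eq_empty[of ?X A B] closure_of_subset[of B ?X]
      by (auto simp: K_def closure_of_subset_topspace Int_commute dest: openin_subset)
    have conn: "connected (E - (S \<inter> K))"
      by (rule no_sep) (use K(1) S not K_def in auto)
    have eq: "E - (S \<inter> K) = (E - K) \<union> B"
      using AB K S_sub by blast
    have "connectedin ?X (E - (S \<inter> K))"
      using conn by (auto simp: connectedin_Euclidean_space_iff)
    moreover have "openin ?X (E - K)" using K(1) by blast
    ultimately show False
      using connectedinD[of ?X "E - (S \<inter> K)" "E - K" B] AB K eq by blast
  qed
  show thesis
  proof (rule that[OF opn un disj conn])
    show "S \<subseteq> ?X closure_of B" by (rule closure[OF un disj opn ne])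
    show "S \<subseteq> ?X closure_of A" by (rule closure[of B A]) (use un disj opn ne in auto)
  qed
qed

lemma closed_hypersurface_sides_homeomorphic:
  assumes Z: "Z homeomorphic_space Euclidean_space (Suc m)" and S: "closedin Z S"
    and U: "openin (Euclidean_space m) U" "connected U" "U \<noteq> {}"
    and hom: "subtopology Z S homeomorphic_space subtopology (Euclidean_space m) U"
  obtains A B where "openin Z A" "openin Z B" "A \<union> B = topspace Z - S" "A \<inter> B = {}"
    "connectedin Z A" "connectedin Z B" "S \<subseteq> Z closure_of A" "S \<subseteq> Z closure_of B"
proof -
  let ?X = "Euclidean_space (Suc m)"
  obtain \<phi> \<psi> where maps: "homeomorphic_maps Z ?X \<phi> \<psi>"
    using Z by (auto simp: homeomorphic_space_def)
  then have \<phi>: "homeomorphic_map Z ?X \<phi>" and \<psi>: "homeomorphic_map ?X Z \<psi>"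
    using homeomorphic_maps_map by blast+
  have inv: "\<And>z. z \<in> topspace Z \<Longrightarrow> \<psi> (\<phi> z) = z"
    using maps by (auto simp: homeomorphic_maps_def)
  have S_sub: "S \<subseteq> topspace Z" using S closedin_subset by blast
  have \<phi>S_sub: "\<phi> ` S \<subseteq> topspace ?X"
    using S_sub homeomorphic_imp_surjective_map[OF \<phi>] by blast
  have \<psi>\<phi>S: "\<psi> ` \<phi> ` S = S" using inv S_sub by (force simp: image_iff)
  have surj: "\<psi> ` topspace ?X = topspace Z" and inj: "inj_on \<psi> (topspace ?X)"
    using homeomorphic_imp_surjective_map[OF \<psi>] homeomorphic_imp_injective_map[OF \<psi>] by blast+
  have cl: "closedin ?X (\<phi> ` S)" using S \<phi> homeomorphic_map_closedness_eq by blast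
  have "homeomorphic_map (subtopology Z S) (subtopology ?X (\<phi> ` S)) \<phi>"
    by (rule homeomorphic_map_subtopologies[OF \<phi>]) (use S_sub \<phi>S_sub in auto)
  then have "subtopology ?X (\<phi> ` S) homeomorphic_space subtopology Z S"
    using homeomorphic_map_imp_homeomorphic_space homeomorphic_space_sym by blast
  then have "subtopology ?X (\<phi> ` S) homeomorphic_space subtopology (Euclidean_space m) U"
    using hom homeomorphic_space_trans by blast
  from closed_hypersurface_sides[OF cl U this] obtain A B where AB:
    "openin ?X A" "openin ?X B" "A \<union> B = topspace ?X - \<phi> ` S" "A \<inter> B = {}"
    "connectedin ?X A" "connectedin ?X B" "\<phi> ` S \<subseteq> ?X closure_of A" "\<phi> ` S \<subseteq> ?X closure_of B"
    by metis
  have sub: "A \<subseteq> topspace ?X" "B \<subseteq> topspace ?X" using AB openin_subset by blast+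
  show thesis
  proof (rule that)
    show "openin Z (\<psi> ` A)" "openin Z (\<psi> ` B)"
      using homeomorphic_map_openness[OF \<psi> sub(1)] homeomorphic_map_openness[OF \<psi> sub(2)] AB(1,2)
      by blast+
    show "connectedin Z (\<psi> ` A)" "connectedin Z (\<psi> ` B)"
      using homeomorphic_map_connectedness[OF \<psi> sub(1)] homeomorphic_map_connectedness[OF \<psi> sub(2)] AB(5,6)
      by blast+
    have "\<psi> ` A \<union> \<psi> ` B = \<psi> ` (topspace ?X - \<phi> ` S)"
      using AB(3) by (metis image_Un)
    also have "\<dots> = topspace Z - S"
      using inj_on_image_set_diff[OF inj, of "topspace ?X" "\<phi> ` S"] surj \<psi>\<phi>S \<phi>S_sub by auto
    finally show "\<psi> ` A \<union> \<psi> ` B = topspace Z - S" .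
    show "\<psi> ` A \<inter> \<psi> ` B = {}"
      using inj_on_image_Int[OF inj sub] AB(4) by simp
    show "S \<subseteq> Z closure_of \<psi> ` A" "S \<subseteq> Z closure_of \<psi> ` B"
      using image_mono[OF AB(7), of \<psi>] image_mono[OF AB(8), of \<psi>]
      unfolding \<psi>\<phi>S homeomorphic_map_closure_of[OF \<psi> sub(1)] homeomorphic_map_closure_of[OF \<psi> sub(2)]
      by blast+
  qed
qed

text \<open>A small open box, identified with the whole space by applying \<open>t / (1 + \<bar>t\<bar>)\<close> in every coordinate.\<close>

lemma Euclidean_space_small_copy:
  assumes "openin (Euclidean_space n) V" "a \<in> V"
  obtains B where "openin (Euclidean_space n) B" "a \<in> B" "B \<subseteq> V"
    "subtopology (Euclidean_space n) B homeomorphic_space Euclidean_space n"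
proof -
  let ?E = "topspace (Euclidean_space n)"
  obtain V0 where V0: "openin (powertop_real UNIV) V0" "V = V0 \<inter> {x. \<forall>i\<ge>n. x i = 0}"
    using assms(1) unfolding Euclidean_space_def by (auto simp: openin_subtopology)
  then have "a \<in> V0" and aE: "a \<in> ?E" using assms by (auto simp: topspace_Euclidean_space)
  obtain I where I: "a \<in> Pi\<^sub>E UNIV I" "\<And>i. open (I i)" "Pi\<^sub>E UNIV I \<subseteq> V0"
    using product_topology_open_contains_basis[OF V0(1) \<open>a \<in> V0\<close>] by auto
  have "\<exists>e>0. \<forall>t. \<bar>t - a i\<bar> < e \<longrightarrow> t \<in> I i" for i
  proof -
    have "a i \<in> I i" using I(1) by auto
    then show ?thesis using I(2)[of i] by (auto simp: open_dist dist_real_def)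
  qed
  then obtain e where e: "\<And>i. e i > 0" "\<And>i t. \<bar>t - a i\<bar> < e i \<Longrightarrow> t \<in> I i"
    by metis
  define B where "B = {x \<in> ?E. \<forall>i<n. \<bar>x i - a i\<bar> < e i}"
  have "open (\<Inter>i\<in>{..<n}. {x::nat \<Rightarrow> real. \<bar>x i - a i\<bar> < e i})"
    by (intro open_INT ballI open_Collect_less continuous_intros) auto
  then have "openin (top_of_set ?E) (?E \<inter> (\<Inter>i\<in>{..<n}. {x. \<bar>x i - a i\<bar> < e i}))"
    by (rule openin_open_Int)
  moreover have "?E \<inter> (\<Inter>i\<in>{..<n}. {x. \<bar>x i - a i\<bar> < e i}) = B"
    by (auto simp: B_def)
  ultimately have opn: "openin (Euclidean_space n) B"
    by (simp add: Euclidean_space_eq_top_of_set)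
  have aB: "a \<in> B" using aE e(1) by (auto simp: B_def)
  have "x \<in> V" if "x \<in> B" for x
  proof -
    have "x i \<in> I i" for i
    proof (cases "i < n")
      case True then show ?thesis using that e(2) by (auto simp: B_def)
    next
      case False
      then have "x i = a i" using that aE by (auto simp: B_def topspace_Euclidean_space)
      then show ?thesis using I(1) by auto
    qed
    then have "x \<in> V0" using I(3) by auto
    then show ?thesis using that V0 by (auto simp: B_def topspace_Euclidean_space)
  qed
  then have "B \<subseteq> V" by blast
  define g where "g = (\<lambda>x i. if i < n then a i + e i * (x i / (1 + \<bar>x i\<bar>)) else 0)"
  define h where "h = (\<lambda>y i. if i < n then ((y i - a i) / e i) / (1 - \<bar>(y i - a i) / e i\<bar>) else 0)"
  have small: "\<bar>(y i - a i) / e i\<bar> < 1" if "y \<in> B" "i < n" for y i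
    using that e(1)[of i] by (auto simp: B_def abs_divide divide_less_eq)
  have "homeomorphic_maps (Euclidean_space n) (subtopology (Euclidean_space n) B) g h"
    unfolding homeomorphic_maps_def
  proof (intro conjI ballI)
    have coord: "continuous_on S (\<lambda>x. x i)" for S :: "(nat \<Rightarrow> real) set" and i
      by (rule continuous_on_subset[OF continuous_on_product_coordinates]) simp
    have "continuous_map (Euclidean_space n) (Euclidean_space n) g"
    proof -
      have "1 + \<bar>t\<bar> \<noteq> 0" for t :: real by linarith
      then show ?thesis
        unfolding g_def continuous_map_componentwise_Euclidean_space
        unfolding Euclidean_space_eq_top_of_set
        by (simp, intro allI impI continuous_intros coord) auto
    qed
    moreover have "g x \<in> B" if "x \<in> ?E" for x
    proof -
      have "\<bar>e i * (x i / (1 + \<bar>x i\<bar>))\<bar> < e i" for i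
      proof -
        have "\<bar>e i * q\<bar> < e i" if "\<bar>q\<bar> < 1" for q
          using mult_strict_left_mono[OF that e(1)] e(1)[of i] by (simp add: abs_mult)
        moreover have "\<bar>x i / (1 + \<bar>x i\<bar>)\<bar> < 1" by (simp add: abs_divide)
        ultimately show ?thesis .
      qed
      then show ?thesis by (auto simp: B_def g_def topspace_Euclidean_space)
    qed
    ultimately show "continuous_map (Euclidean_space n) (subtopology (Euclidean_space n) B) g"
      by (auto simp: continuous_map_in_subtopology)
    have ne: "1 - \<bar>(y i - a i) / e i\<bar> \<noteq> 0" if "y \<in> B" "i < n" for y i
      using small[OF that] by linarith
    have ne': "e i \<noteq> 0" for i using e(1)[of i] by linarith
    show "continuous_map (subtopology (Euclidean_space n) B) (Euclidean_space n) h"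
      unfolding h_def continuous_map_componentwise_Euclidean_space
      unfolding Euclidean_space_eq_top_of_set subtopology_subtopology
      by (simp, intro allI impI continuous_intros coord) (use ne ne' in auto)
    show "h (g x) = x" if "x \<in> topspace (Euclidean_space n)" for x
    proof
      fix i
      show "h (g x) i = x i"
      proof (cases "i < n")
        case True
        have "(g x i - a i) / e i = x i / (1 + \<bar>x i\<bar>)"
          using True e(1)[of i] by (simp add: g_def)
        moreover have "1 - \<bar>x i / (1 + \<bar>x i\<bar>)\<bar> = 1 / (1 + \<bar>x i\<bar>)"
          by (simp add: abs_divide field_simps)
        ultimately have "h (g x) i = (x i / (1 + \<bar>x i\<bar>)) / (1 / (1 + \<bar>x i\<bar>))"
          using True by (simp only: h_def if_True)
        also have "\<dots> = x i" by simp
        finally show ?thesis .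
      qed (use that in \<open>auto simp: h_def topspace_Euclidean_space\<close>)
    qed
    show "g (h y) = y" if "y \<in> topspace (subtopology (Euclidean_space n) B)" for y
    proof
      fix i
      have y: "y \<in> B" using that by auto
      show "g (h y) i = y i"
      proof (cases "i < n")
        case True
        define t where "t = (y i - a i) / e i"
        have t: "\<bar>t\<bar> < 1" using small[OF y True] by (simp add: t_def)
        have "h y i = t / (1 - \<bar>t\<bar>)" using True by (simp add: h_def t_def)
        moreover have "(t / (1 - \<bar>t\<bar>)) / (1 + \<bar>t / (1 - \<bar>t\<bar>)\<bar>) = t"
          using t by (simp add: abs_divide field_simps)
        ultimately have "g (h y) i = a i + e i * t" using True by (simp add: g_def)
        then show ?thesis using e(1)[of i] by (simp add: t_def)
      qed (use y in \<open>auto simp: B_def g_def topspace_Euclidean_space\<close>)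
    qed
  qed
  then have "subtopology (Euclidean_space n) B homeomorphic_space Euclidean_space n"
    using homeomorphic_space_def homeomorphic_space_sym by blast
  with opn aB \<open>B \<subseteq> V\<close> that show thesis by blast
qed

lemma Euclidean_neighbourhood:
  assumes M: "topological_manifold n X" and N: "openin X N" "x \<in> N"
  obtains W where "openin X W" "x \<in> W" "W \<subseteq> N" "subtopology X W homeomorphic_space Euclidean_space n"
proof -
  let ?E = "Euclidean_space n"
  have "x \<in> topspace X" using N openin_subset by blast
  then obtain U V where UV: "openin X U" "x \<in> U" "openin ?E V"
    "subtopology X U homeomorphic_space subtopology ?E V"
    using M unfolding topological_manifold_def by blast
  then obtain \<phi> \<psi> where maps: "homeomorphic_maps (subtopology X U) (subtopology ?E V) \<phi> \<psi>"
    by (auto simp: homeomorphic_space_def)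
  then have \<phi>: "homeomorphic_map (subtopology X U) (subtopology ?E V) \<phi>"
    and \<psi>: "homeomorphic_map (subtopology ?E V) (subtopology X U) \<psi>"
    using homeomorphic_maps_map by blast+
  have top: "topspace (subtopology X U) = U" "topspace (subtopology ?E V) = V"
    using UV openin_subset by auto
  have inv: "\<And>z. z \<in> U \<Longrightarrow> \<psi> (\<phi> z) = z"
    using maps top by (auto simp: homeomorphic_maps_def)
  have "openin (subtopology X U) (U \<inter> N)" using N by (simp add: openin_subtopology_Int2)
  then have "openin (subtopology ?E V) (\<phi> ` (U \<inter> N))"
    using \<phi> homeomorphic_map_openness_eq by blast
  then have "openin ?E (\<phi> ` (U \<inter> N))" using UV(3) openin_trans_full by blast
  then obtain B where B: "openin ?E B" "\<phi> x \<in> B" "B \<subseteq> \<phi> ` (U \<inter> N)"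
    "subtopology ?E B homeomorphic_space ?E"
    using Euclidean_space_small_copy[of n "\<phi> ` (U \<inter> N)" "\<phi> x"] UV(2) N(2) by blast
  have BV: "B \<subseteq> V" using B(3) homeomorphic_imp_surjective_map[OF \<phi>] top by blast
  have img: "\<psi> ` B \<subseteq> U \<inter> N" using B(3) inv by force
  show thesis
  proof (rule that)
    have "openin (subtopology ?E V) B" using B(1) BV openin_open_subtopology UV(3) by blast
    then have "openin (subtopology X U) (\<psi> ` B)"
      using \<psi> homeomorphic_map_openness_eq by blast
    then show "openin X (\<psi> ` B)" using UV(1) openin_trans_full by blast
    show "x \<in> \<psi> ` B" using inv UV(2) B(2) by (metis imageI)
    show "\<psi> ` B \<subseteq> N" using img by blast
    have "homeomorphic_map (subtopology (subtopology ?E V) B) (subtopology (subtopology X U) (\<psi> ` B)) \<psi>"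
      by (rule homeomorphic_map_subtopologies[OF \<psi>]) (use top BV img in auto)
    then have "subtopology ?E B homeomorphic_space subtopology X (\<psi> ` B)"
      using BV img homeomorphic_map_imp_homeomorphic_space
      by (simp add: subtopology_subtopology inf.absorb2)
    then show "subtopology X (\<psi> ` B) homeomorphic_space ?E"
      using B(4) homeomorphic_space_sym homeomorphic_space_trans by blast
  qed
qed

section \<open>Connected closed hypersurfaces in manifolds\<close>

text \<open>Near a point of \<open>Y\<close> too, the constant is determined by density, so these constants form a locally constant
function on all of \<open>A\<close>.\<close>

lemma agree_near_const_on_connected:
  assumes A: "openin X A" "connectedin X A"
    and dense: "\<And>N z. openin X N \<Longrightarrow> z \<in> N \<Longrightarrow> \<exists>w\<in>N. w \<notin> Y"
    and const: "\<And>x. x \<in> A \<Longrightarrow> \<exists>k. agree_near X Y x g (\<lambda>_. k)"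
  obtains k where "\<And>w. w \<in> A \<Longrightarrow> w \<notin> Y \<Longrightarrow> g w = k"
proof -
  define C where "C = (\<lambda>k. {x \<in> A. agree_near X Y x g (\<lambda>_. k)})"
  have opn: "openin X (C k)" for k
  proof (subst openin_subopen, intro ballI)
    fix x assume x: "x \<in> C k"
    then obtain N where "openin X N" "x \<in> N" "\<And>w. w \<in> N \<Longrightarrow> agree_near X Y w g (\<lambda>_. k)"
      using agree_near_eventually[of X Y x g "\<lambda>_. k"] unfolding C_def by blast
    then show "\<exists>T. openin X T \<and> x \<in> T \<and> T \<subseteq> C k"
      using x A(1) by (intro exI[of _ "N \<inter> A"]) (auto simp: C_def)
  qed
  have off: "g w = k" if "w \<in> C k" "w \<notin> Y" for w k
    using that unfolding C_def agree_near_def by blast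
  have "C True \<inter> C False = {}"
  proof (rule ccontr)
    assume "C True \<inter> C False \<noteq> {}"
    then obtain w where "w \<in> C True \<inter> C False" "w \<notin> Y"
      using dense[of "C True \<inter> C False"] opn by blast
    then show False using off by blast
  qed
  moreover have "A \<subseteq> C True \<union> C False"
  proof
    fix x assume x: "x \<in> A"
    then obtain k where "agree_near X Y x g (\<lambda>_. k)" using const by blast
    then show "x \<in> C True \<union> C False" using x by (cases k) (auto simp: C_def)
  qed
  moreover have "C k \<subseteq> A" for k by (auto simp: C_def)
  ultimately have "A \<subseteq> C True \<or> A \<subseteq> C False"
    using connectedinD[OF A(2) opn[of True] opn[of False]] by blast
  then obtain k where "A \<subseteq> C k" by blast
  then show thesis
    using off that[of k] by blast
qed

lemma no_mod2_cohomology_contractible: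
  assumes "contractible_space X"
  shows "no_mod2_cohomology X"
proof (cases "topspace X = {}")
  case True
  then have "trivial_group (homology_group 1 X)"
    by (simp add: trivial_homology_group_empty)
  then show ?thesis
    by (auto simp: no_mod2_cohomology_def trivial_homomorphism_def trivial_group_def hom_one)
next
  case False
  have "trivial_group (reduced_homology_group 1 X)"
    using assms by (rule trivial_reduced_homology_group_contractible_space)
  then have "trivial_group (homology_group 1 X)"
    by (simp add: un_reduced_homology_group)
  then show ?thesis
    by (auto simp: no_mod2_cohomology_def trivial_homomorphism_def trivial_group_def hom_one)
qed

locale closed_hypersurface =
  fixes X :: "'a topology" and Y :: "'a set" and m :: nat
  assumes manifold: "topological_manifold (Suc m) X"
    and submanifold: "topological_submanifold m X Y"
    and closed: "closedin X Y"
begin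

text \<open>The local picture at a point of \<open>Y\<close>: in a coordinate neighbourhood \<open>W\<close>, the set \<open>M\<close> is a piece of
\<open>W \<inter> Y\<close>, in practice the component of a given point, and \<open>A\<close> and \<open>B\<close> are the two sides of \<open>M\<close> in \<open>W\<close>. A wild \<open>Y\<close> may meet every small
\<open>W\<close> in many components, which is why \<open>M\<close> is kept apart from the rest of \<open>W \<inter> Y\<close>. The two openness
conditions say that \<open>M\<close> and this rest are closed in \<open>W\<close>.\<close>

definition local_sides :: "'a set \<Rightarrow> 'a set \<Rightarrow> 'a set \<Rightarrow> 'a set \<Rightarrow> bool" where
  "local_sides W M A B \<longleftrightarrow>
     openin X W \<and> subtopology X W homeomorphic_space Euclidean_space (Suc m) \<and>
     M \<subseteq> W \<inter> Y \<and> openin X (W - M) \<and> openin X (W - (W \<inter> Y - M)) \<and>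
     openin X A \<and> openin X B \<and> A \<union> B = W - M \<and> A \<inter> B = {} \<and>
     connectedin X A \<and> connectedin X B \<and> M \<subseteq> X closure_of A \<and> M \<subseteq> X closure_of B"

text \<open>If \<open>W\<close> is small enough, a chart of \<open>Y\<close> identifies the component \<open>M\<close> with a connected open subset of
\<open>\<real>\<^sup>m\<close>. As \<open>M\<close> is closed in \<open>W\<close>, which is a copy of \<open>\<real>\<^bsup>m+1\<^esup>\<close>, the result on closed
hypersurfaces applies.\<close>

lemma local_sides_exist:
  assumes y: "y \<in> Y" and N: "openin X N" "y \<in> N"
  obtains W M A B where "local_sides W M A B" "y \<in> M" "W \<subseteq> N"
proof -
  let ?E = "Euclidean_space m"
  have Y_sub: "Y \<subseteq> topspace X" using closed closedin_subset by blast
  have "topological_manifold m (subtopology X Y)"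
    using submanifold by (simp add: topological_submanifold_def)
  moreover have "y \<in> topspace (subtopology X Y)" using y Y_sub by auto
  ultimately obtain U V where UV: "openin (subtopology X Y) U" "y \<in> U" "openin ?E V"
    "subtopology (subtopology X Y) U homeomorphic_space subtopology ?E V"
    unfolding topological_manifold_def by blast
  obtain N' where N': "openin X N'" "U = N' \<inter> Y"
    using UV(1) by (auto simp: openin_subtopology)
  obtain W where W: "openin X W" "y \<in> W" "W \<subseteq> N \<inter> N'"
    "subtopology X W homeomorphic_space Euclidean_space (Suc m)"
    using Euclidean_neighbourhood[OF manifold, of "N \<inter> N'" y] N N' UV(2) by blast
  define P where "P = W \<inter> Y"
  have P: "P \<subseteq> U" "P \<subseteq> topspace X" "y \<in> P"
    using W N' Y_sub y by (auto simp: P_def)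
  have XU: "subtopology (subtopology X Y) U = subtopology X U"
    using N'(2) by (simp add: subtopology_subtopology inf.absorb2)
  obtain \<phi> where \<phi>: "homeomorphic_map (subtopology X U) (subtopology ?E V) \<phi>"
    using UV(4) unfolding XU homeomorphic_space by blast
  have top: "topspace (subtopology X U) = U" "topspace (subtopology ?E V) = V"
    using UV(3) openin_subset N' Y_sub by auto
  have im\<phi>: "\<phi> ` U = V" using \<phi> homeomorphic_imp_surjective_map top by metis
  define Q where "Q = \<phi> ` P"
  have QV: "Q \<subseteq> V" using im\<phi> P by (auto simp: Q_def)
  have "P = U \<inter> W" using W(3) N'(2) by (auto simp: P_def)
  then have "openin (subtopology X U) P"
    using W(1) by (simp add: openin_subtopology_Int2)
  then have "openin (subtopology ?E V) Q"
    using \<phi> homeomorphic_map_openness[OF \<phi>, of P] top P Q_def by simp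
  then have Q: "openin ?E Q" using UV(3) openin_trans_full by blast
  have "homeomorphic_map (subtopology (subtopology X U) P) (subtopology (subtopology ?E V) Q) \<phi>"
    by (rule homeomorphic_map_subtopologies[OF \<phi>]) (use top P QV Q_def in auto)
  then have \<phi>P: "homeomorphic_map (subtopology X P) (subtopology ?E Q) \<phi>"
    using P QV by (simp add: subtopology_subtopology inf.absorb2)
  have topP: "topspace (subtopology X P) = P" "topspace (subtopology ?E Q) = Q"
    using P openin_subset[OF Q] by auto
  have "locally_connected_space (subtopology ?E Q)"
    using Q by (intro locally_connected_space_open_subset locally_path_connected_imp_locally_connected_space
        locally_path_connected_Euclidean_space)
  then have lc: "locally_connected_space (subtopology X P)"
    using homeomorphic_locally_connected_space \<phi>P homeomorphic_map_imp_homeomorphic_space by blast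
  define M where "M = connected_component_of_set (subtopology X P) y"
  have MP: "M \<subseteq> P" using connected_component_of_subset_topspace[of "subtopology X P" y] topP M_def by auto
  have yM: "y \<in> M" using P topP by (auto simp: M_def connected_component_of_refl)
  have M_open: "openin (subtopology X P) M" and M_closed: "closedin (subtopology X P) M"
    unfolding M_def by (auto simp: lc openin_connected_component_of_locally_connected_space closedin_connected_component_of)
  have M_conn: "connectedin (subtopology X P) M"
    unfolding M_def by (rule connectedin_connected_component_of)
  have \<phi>M_sub: "\<phi> ` M \<subseteq> Q" using MP by (auto simp: Q_def)
  have "openin (subtopology ?E Q) (\<phi> ` M)"
    using homeomorphic_map_openness[OF \<phi>P, of M] M_open MP P(2) topP by simp
  then have \<phi>M_open: "openin ?E (\<phi> ` M)" using Q openin_trans_full by blast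
  have "connectedin (subtopology ?E Q) (\<phi> ` M)"
    using homeomorphic_map_connectedness[OF \<phi>P, of M] M_conn MP P(2) topP by simp
  then have \<phi>M_conn: "connected (\<phi> ` M)"
    by (simp add: connectedin_subtopology connectedin_Euclidean_space_iff)
  have "homeomorphic_map (subtopology (subtopology X P) M) (subtopology (subtopology ?E Q) (\<phi> ` M)) \<phi>"
    by (rule homeomorphic_map_subtopologies[OF \<phi>P]) (use topP MP \<phi>M_sub in auto)
  then have homM: "subtopology X M homeomorphic_space subtopology ?E (\<phi> ` M)"
    using MP \<phi>M_sub homeomorphic_map_imp_homeomorphic_space
    by (simp add: subtopology_subtopology inf.absorb2)
  let ?Z = "subtopology X W"
  have topZ: "topspace ?Z = W" using W(1) openin_subset by auto
  have PW: "P \<subseteq> W" by (simp add: P_def)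
  have ZP: "subtopology ?Z P = subtopology X P" and ZM: "subtopology ?Z M = subtopology X M"
    using PW MP by (simp_all add: subtopology_subtopology inf.absorb2)
  have P_closed: "closedin ?Z P"
    using closed by (simp add: P_def closedin_subtopology_Int_closed)
  have M_closedZ: "closedin ?Z M"
    using M_closed P_closed ZP closedin_trans_full by metis
  have "closedin (subtopology X P) (P - M)"
    using M_open topP by (metis closedin_def closedin_diff closedin_topspace)
  then have R_closedZ: "closedin ?Z (P - M)"
    using P_closed ZP closedin_trans_full by metis
  have open_diff: "openin X (W - C)" if "closedin ?Z C" for C
    using that W(1) topZ by (metis openin_diff openin_topspace openin_trans_full)
  obtain A B where AB: "openin ?Z A" "openin ?Z B" "A \<union> B = topspace ?Z - M" "A \<inter> B = {}"
    "connectedin ?Z A" "connectedin ?Z B" "M \<subseteq> ?Z closure_of A" "M \<subseteq> ?Z closure_of B"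
    using closed_hypersurface_sides_homeomorphic[OF W(4) M_closedZ \<phi>M_open \<phi>M_conn] homM ZM yM
    by (metis image_is_empty empty_iff)
  have "local_sides W M A B"
    unfolding local_sides_def
  proof (intro conjI)
    show "openin X A" "openin X B" using AB W(1) openin_trans_full by blast+
    show "connectedin X A" "connectedin X B" using AB by (auto simp: connectedin_subtopology)
    show "M \<subseteq> X closure_of A" "M \<subseteq> X closure_of B"
      using AB(7,8) closure_of_subtopology_subset[of X W] by (meson order_trans)+
    show "A \<union> B = W - M" using AB(3) topZ by simp
    show "openin X (W - M)" "openin X (W - (W \<inter> Y - M))"
      using open_diff M_closedZ R_closedZ by (auto simp: P_def)
    show "M \<subseteq> W \<inter> Y" using MP by (simp add: P_def)
  qed (use W AB in auto)
  then show thesis using that yM W(3) by blast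
qed

lemma complement_dense:
  assumes N: "openin X N" "z \<in> N"
  shows "\<exists>w\<in>N. w \<notin> Y"
proof (cases "z \<in> Y")
  case True
  obtain W M A B where L: "local_sides W M A B" "z \<in> M" "W \<subseteq> N"
    using local_sides_exist[OF True N] .
  let ?V = "W - (W \<inter> Y - M)"
  have "z \<in> X closure_of A" "openin X ?V" "z \<in> ?V" "A \<union> B = W - M" "M \<subseteq> W \<inter> Y"
    using L by (auto simp: local_sides_def)
  then obtain w where "w \<in> A" "w \<in> ?V"
    unfolding in_closure_of by meson
  then show ?thesis
    using \<open>A \<union> B = W - M\<close> L(3) by blast
qed (use N in blast)

definition locally_constant_off :: "'a set \<Rightarrow> ('a \<Rightarrow> bool) \<Rightarrow> bool" where
  "locally_constant_off N g \<longleftrightarrow> (\<forall>x\<in>N - Y. agree_near X Y x g (\<lambda>_. g x))"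

lemma open_level:
  assumes "locally_constant_off (topspace X) F"
  shows "openin X {w \<in> topspace X - Y. F w = c}"
proof (subst openin_subopen, intro ballI)
  fix x assume x: "x \<in> {w \<in> topspace X - Y. F w = c}"
  then have "agree_near X Y x F (\<lambda>_. F x)"
    using assms unfolding locally_constant_off_def by blast
  then obtain N where N: "openin X N" "x \<in> N" "\<forall>w\<in>N - Y. F w = F x"
    unfolding agree_near_def by blast
  moreover have "openin X (topspace X - Y)" using closed by blast
  ultimately show "\<exists>T. openin X T \<and> x \<in> T \<and> T \<subseteq> {w \<in> topspace X - Y. F w = c}"
    using x by (intro exI[of _ "N \<inter> (topspace X - Y)"]) auto
qed

text \<open>The space \<open>W\<close> is the union of the open sets \<open>W - M\<close> and \<open>W - M'\<close>, where \<open>M'\<close> is the rest of \<open>W \<inter> Y\<close>.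
Since \<open>W\<close> has no first cohomology, the function \<open>g\<close> on their intersection is a sum of a locally constant
function \<open>F\<close> on \<open>W - M\<close> and one on \<open>W - M'\<close>: this is a global section of the double cover glued along
\<open>g\<close>. The function \<open>F\<close> is constant on \<open>A\<close> and on \<open>B\<close>, and the other summand is constant near \<open>y\<close>.\<close>

lemma germ_from_sides:
  assumes L: "local_sides W M A B" and y: "y \<in> M" and g: "locally_constant_off W g"
  shows "(\<exists>k. agree_near X Y y g (\<lambda>_. k)) \<or> (\<exists>k. agree_near X Y y g (\<lambda>w. k \<noteq> (w \<in> A)))"
proof -
  let ?Z = "subtopology X W"
  define f where "f = (\<lambda>x. if x \<in> M then g else (\<lambda>_. False))"
  note L' = L[unfolded local_sides_def]
  have W: "openin X W" "W \<subseteq> topspace X" using L' openin_subset by blast+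
  have openZ: "openin ?Z S \<longleftrightarrow> openin X S \<and> S \<subseteq> W" for S
    using W by (simp add: openin_open_subtopology)
  have near: "agree_near ?Z Y x a b \<longleftrightarrow> agree_near X Y x a b" if "x \<in> W" for x a b
  proof
    assume "agree_near X Y x a b"
    then obtain N where "openin X N" "x \<in> N" "\<forall>w\<in>N - Y. a w = b w"
      unfolding agree_near_def by blast
    then show "agree_near ?Z Y x a b"
      using W that by (intro agree_nearI[of _ "N \<inter> W"]) (auto simp: openZ)
  qed (auto simp: agree_near_def openZ)
  \<comment> \<open>The double cover with transition function \<open>g\<close> between \<open>W - M\<close> and \<open>W - M'\<close>.\<close>
  interpret Z: double_cover ?Z Y f
  proof
    show "\<exists>w\<in>N. w \<notin> Y" if "openin ?Z N" "z \<in> N" for N z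
      using that complement_dense openZ by blast
    fix x assume "x \<in> topspace ?Z"
    then have x: "x \<in> W" by simp
    show "\<exists>N. openin ?Z N \<and> x \<in> N \<and> (\<forall>z\<in>N. \<exists>k. agree_near ?Z Y z (f x) (\<lambda>w. f z w \<noteq> k))"
    proof (cases "x \<in> M")
      case True
      let ?N = "W - (W \<inter> Y - M)"
      have "\<exists>k. agree_near ?Z Y z (f x) (\<lambda>w. f z w \<noteq> k)" if z: "z \<in> ?N" for z
      proof (cases "z \<in> M")
        case True
        moreover have "z \<in> topspace ?Z" using z W by auto
        ultimately have "agree_near ?Z Y z (f x) (\<lambda>w. f z w \<noteq> False)"
          using \<open>x \<in> M\<close> by (simp add: f_def agree_near_refl)
        then show ?thesis ..
      next
        case False
        then have "z \<in> W - Y" using z by blast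
        then have "agree_near X Y z g (\<lambda>_. g z)" using g by (simp add: locally_constant_off_def)
        then have "agree_near ?Z Y z (f x) (\<lambda>w. f z w \<noteq> g z)"
          using \<open>x \<in> M\<close> False z by (simp add: f_def near)
        then show ?thesis ..
      qed
      then show ?thesis
        using L' True x by (intro exI[of _ ?N]) (auto simp: openZ)
    next
      case False
      have "\<exists>k. agree_near ?Z Y z (f x) (\<lambda>w. f z w \<noteq> k)" if "z \<in> W - M" for z
      proof (rule exI[of _ False])
        have "z \<in> topspace ?Z" using that W by auto
        then show "agree_near ?Z Y z (f x) (\<lambda>w. f z w \<noteq> False)"
          using False that by (simp add: f_def agree_near_refl)
      qed
      then show ?thesis
        using L' False x by (intro exI[of _ "W - M"]) (auto simp: openZ)
    qed
  qed
  have hom: "?Z homeomorphic_space Euclidean_space (Suc m)" using L' by blast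
  have "no_mod2_cohomology ?Z"
    using homeomorphic_space_contractibility[OF hom] by (intro no_mod2_cohomology_contractible) simp
  moreover have "path_connected_space ?Z"
    using homeomorphic_path_connected_space[OF hom] path_connected_Euclidean_space by blast
  moreover have "locally_path_connected_space ?Z"
    using homeomorphic_locally_path_connected_space[OF hom] locally_path_connected_Euclidean_space by blast
  ultimately obtain F where F: "\<And>x. x \<in> topspace ?Z \<Longrightarrow> \<exists>k. agree_near ?Z Y x F (\<lambda>w. k \<noteq> f x w)"
    using Z.global_section_exists by metis
  have const: "\<exists>k. agree_near X Y x F (\<lambda>_. k)" if x: "x \<in> W - M" for x
  proof -
    obtain k where "agree_near ?Z Y x F (\<lambda>w. k \<noteq> f x w)" using F[of x] x W by auto
    then show ?thesis using x near[of x] by (auto simp: f_def)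
  qed
  have constant_value: "\<exists>a. \<forall>w\<in>C. w \<notin> Y \<longrightarrow> F w = a"
    if C: "openin X C" "connectedin X C" "C \<subseteq> W - M" for C
  proof (rule agree_near_const_on_connected[OF C(1,2), of Y F])
    show "\<exists>w\<in>N. w \<notin> Y" if "openin X N" "z \<in> N" for N z
      using complement_dense[OF that] .
    show "\<exists>k. agree_near X Y x F (\<lambda>_. k)" if "x \<in> C" for x
      by (rule const) (use that C(3) in blast)
    show ?thesis if "\<And>w. w \<in> C \<Longrightarrow> w \<notin> Y \<Longrightarrow> F w = k" for k
      by (intro exI[of _ k]) (simp add: that)
  qed
  have "A \<subseteq> W - M" "B \<subseteq> W - M" using L' by blast+
  then obtain a b where a: "\<forall>w\<in>A. w \<notin> Y \<longrightarrow> F w = a" and b: "\<forall>w\<in>B. w \<notin> Y \<longrightarrow> F w = b"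
    using constant_value[of A] constant_value[of B] L' by metis
  have "y \<in> W" using y L' by blast
  then obtain k where "agree_near ?Z Y y F (\<lambda>w. k \<noteq> g w)"
    using F[of y] W y by (auto simp: f_def)
  then have "agree_near X Y y F (\<lambda>w. k \<noteq> g w)" using near \<open>y \<in> W\<close> by blast
  then obtain N where N: "openin X N" "y \<in> N" "\<And>w. w \<in> N \<Longrightarrow> w \<notin> Y \<Longrightarrow> F w = (k \<noteq> g w)"
    unfolding agree_near_def by blast
  let ?N = "N \<inter> W"
  have N': "openin X ?N" "y \<in> ?N" using N W \<open>y \<in> W\<close> by auto
  have g_eq: "g w = (if w \<in> A then k \<noteq> a else k \<noteq> b)" if w: "w \<in> ?N" "w \<notin> Y" for w
  proof -
    have "w \<in> A \<or> w \<in> B" using w L' by blast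
    then show ?thesis using N(3)[of w] a b w by auto
  qed
  show ?thesis
  proof (cases "a = b")
    case True
    then have "agree_near X Y y g (\<lambda>_. k \<noteq> a)"
      using g_eq by (intro agree_nearI[OF N']) auto
    then show ?thesis by blast
  next
    case False
    then have "agree_near X Y y g (\<lambda>w. (k \<noteq> b) \<noteq> (w \<in> A))"
      using g_eq by (intro agree_nearI[OF N']) auto
    then show ?thesis by blast
  qed
qed

text \<open>Locally, \<open>Y\<close> has just two sides: modulo constants there is at most one nonzero germ of a locally constant
function on the complement.\<close>

lemma germ_dichotomy:
  assumes y: "y \<in> Y" and N: "openin X N" "y \<in> N"
    and g: "locally_constant_off N g" and h: "locally_constant_off N h"
    and h_jump: "\<And>k. \<not> agree_near X Y y h (\<lambda>_. k)"
  shows "(\<exists>k. agree_near X Y y g (\<lambda>_. k)) \<or> (\<exists>k. agree_near X Y y g (\<lambda>w. k \<noteq> h w))"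
proof -
  obtain W M A B where L: "local_sides W M A B" "y \<in> M" "W \<subseteq> N"
    using local_sides_exist[OF y N] .
  have gW: "locally_constant_off W g" and hW: "locally_constant_off W h"
    using g h L(3) by (auto simp: locally_constant_off_def)
  obtain k where k: "agree_near X Y y h (\<lambda>w. k \<noteq> (w \<in> A))"
    using germ_from_sides[OF L(1,2) hW] h_jump by blast
  from germ_from_sides[OF L(1,2) gW] show ?thesis
  proof
    assume "\<exists>l. agree_near X Y y g (\<lambda>w. l \<noteq> (w \<in> A))"
    then obtain l where "agree_near X Y y g (\<lambda>w. l \<noteq> (w \<in> A))" ..
    then obtain P where P: "openin X P" "y \<in> P" "\<And>w. w \<in> P - Y \<Longrightarrow> g w = (l \<noteq> (w \<in> A))"
      unfolding agree_near_def by blast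
    obtain Q where Q: "openin X Q" "y \<in> Q" "\<And>w. w \<in> Q - Y \<Longrightarrow> h w = (k \<noteq> (w \<in> A))"
      using k unfolding agree_near_def by blast
    have "agree_near X Y y g (\<lambda>w. (l \<noteq> k) \<noteq> h w)"
    proof (rule agree_nearI[of X "P \<inter> Q"])
      fix w assume "w \<in> P \<inter> Q" "w \<notin> Y"
      then show "g w = ((l \<noteq> k) \<noteq> h w)" using P(3)[of w] Q(3)[of w] by auto
    qed (use P Q in auto)
    then show ?thesis by blast
  qed blast
qed

lemma sides_jump:
  assumes L: "local_sides W M A B" and y: "y \<in> M"
  shows "\<not> agree_near X Y y (\<lambda>w. w \<in> A) (\<lambda>_. k)"
proof
  note L' = L[unfolded local_sides_def]
  assume "agree_near X Y y (\<lambda>w. w \<in> A) (\<lambda>_. k)"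
  then obtain N where N: "openin X N" "y \<in> N" "\<And>w. w \<in> N - Y \<Longrightarrow> (w \<in> A) = k"
    unfolding agree_near_def by blast
  have open_meets: "\<exists>w\<in>C. w \<in> N \<and> w \<notin> Y" if C: "openin X C" "M \<subseteq> X closure_of C" for C
  proof -
    have "y \<in> X closure_of C" using C(2) y by blast
    then obtain z where "z \<in> C" "z \<in> N" using N(1,2) unfolding in_closure_of by meson
    then show ?thesis using complement_dense[of "C \<inter> N" z] C N by auto
  qed
  obtain w w' where "w \<in> A" "w \<in> N" "w \<notin> Y" "w' \<in> B" "w' \<in> N" "w' \<notin> Y"
    using open_meets[of A] open_meets[of B] L' by metis
  then show False using N(3)[of w] N(3)[of w'] L' by blast
qed

lemma sides_locally_constant:
  assumes L: "local_sides W M A B"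
  shows "locally_constant_off (W - (W \<inter> Y - M)) (\<lambda>w. w \<in> A)"
  unfolding locally_constant_off_def
proof
  note L' = L[unfolded local_sides_def]
  fix x assume "x \<in> W - (W \<inter> Y - M) - Y"
  then have "x \<in> W - M" using L' by blast
  then have "x \<in> A \<or> x \<in> B" using L' by blast
  then show "agree_near X Y x (\<lambda>w. w \<in> A) (\<lambda>_. x \<in> A)"
  proof
    assume "x \<in> A"
    then show ?thesis using L' by (intro agree_nearI[of X A]) auto
  next
    assume "x \<in> B"
    then show ?thesis using L' by (intro agree_nearI[of X B]) auto
  qed
qed

definition side_at :: "'a \<Rightarrow> 'a set" where
  "side_at y = (SOME A. \<exists>W M B. local_sides W M A B \<and> y \<in> M)"

lemma side_at:
  assumes "y \<in> Y"
  obtains W M B where "local_sides W M (side_at y) B" "y \<in> M"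
proof -
  have "y \<in> topspace X" using assms closed closedin_subset by blast
  then have "\<exists>A W M B. local_sides W M A B \<and> y \<in> M"
    using local_sides_exist[OF assms, of "topspace X"] by (metis openin_topspace)
  from someI_ex[OF this] show thesis
    using that unfolding side_at_def by blast
qed

text \<open>Over a point of \<open>Y\<close> the fibre of the bundle is the set of its two sides; over the complement of \<open>Y\<close>
the bundle is trivialised by the constant functions.\<close>

definition germ_at :: "'a \<Rightarrow> 'a \<Rightarrow> bool" where
  "germ_at x = (if x \<in> Y then (\<lambda>w. w \<in> side_at x) else (\<lambda>_. False))"

text \<open>At a point \<open>z\<close> of \<open>Y\<close> near \<open>x\<close>, the sides chosen at \<open>x\<close> and at \<open>z\<close> both give a nonconstant
germ. The two agree up to a constant by the uniqueness of such germs.\<close>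

lemma double_cover_sides: "double_cover X Y germ_at"
proof
  show "\<exists>w\<in>N. w \<notin> Y" if "openin X N" "z \<in> N" for N z
    using complement_dense that .
  fix x assume x: "x \<in> topspace X"
  show "\<exists>N. openin X N \<and> x \<in> N \<and> (\<forall>z\<in>N. \<exists>k. agree_near X Y z (germ_at x) (\<lambda>w. germ_at z w \<noteq> k))"
  proof (cases "x \<in> Y")
    case False
    have "\<exists>k. agree_near X Y z (germ_at x) (\<lambda>w. germ_at z w \<noteq> k)" if "z \<in> topspace X - Y" for z
      by (rule exI[of _ False]) (use False that in \<open>auto simp: germ_at_def intro: agree_near_refl\<close>)
    then show ?thesis
      using False x closed by (intro exI[of _ "topspace X - Y"]) auto
  next
    case True
    obtain W M B where L: "local_sides W M (side_at x) B" "x \<in> M" using side_at[OF True] .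
    note L' = L(1)[unfolded local_sides_def]
    let ?N = "W - (W \<inter> Y - M)"
    have N: "openin X ?N" "x \<in> ?N" using L' L(2) by auto
    have lc: "locally_constant_off ?N (germ_at x)"
      using sides_locally_constant[OF L(1)] True by (simp add: germ_at_def)
    have "\<exists>k. agree_near X Y z (germ_at x) (\<lambda>w. germ_at z w \<noteq> k)" if z: "z \<in> ?N" for z
    proof (cases "z \<in> Y")
      case False
      then have "agree_near X Y z (germ_at x) (\<lambda>_. germ_at x z)"
        using lc z by (auto simp: locally_constant_off_def)
      then have "agree_near X Y z (germ_at x) (\<lambda>w. germ_at z w \<noteq> germ_at x z)"
        using False by (simp add: germ_at_def[of z])
      then show ?thesis ..
    next
      case zY: True
      then have zM: "z \<in> M" using z by blast
      obtain W' M' B' where L2: "local_sides W' M' (side_at z) B'" "z \<in> M'" using side_at[OF zY] .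
      note L2' = L2(1)[unfolded local_sides_def]
      let ?N' = "W' - (W' \<inter> Y - M')"
      have N': "openin X ?N'" "z \<in> ?N'" using L2' L2(2) by auto
      have "locally_constant_off (?N \<inter> ?N') (germ_at z)"
        using sides_locally_constant[OF L2(1)] zY by (auto simp: germ_at_def locally_constant_off_def)
      moreover have "locally_constant_off (?N \<inter> ?N') (germ_at x)"
        using lc by (auto simp: locally_constant_off_def)
      moreover have "\<not> agree_near X Y z (germ_at z) (\<lambda>_. k)" for k
        using sides_jump[OF L2] zY by (simp add: germ_at_def)
      moreover have "\<not> agree_near X Y z (germ_at x) (\<lambda>_. k)" for k
        using sides_jump[OF L(1) zM] True by (simp add: germ_at_def)
      ultimately obtain k where "agree_near X Y z (germ_at x) (\<lambda>w. k \<noteq> germ_at z w)"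
        using germ_dichotomy[OF zY, of "?N \<inter> ?N'" "germ_at x" "germ_at z"] N N' z by blast
      moreover have "(\<lambda>w. k \<noteq> germ_at z w) = (\<lambda>w. germ_at z w \<noteq> k)" by auto
      ultimately have "agree_near X Y z (germ_at x) (\<lambda>w. germ_at z w \<noteq> k)" by simp
      then show ?thesis ..
    qed
    then show ?thesis using N by blast
  qed
qed

lemma locally_path_connected: "locally_path_connected_space X"
  unfolding locally_path_connected_space
proof (intro allI impI, elim conjE)
  fix V x assume V: "openin X V" "x \<in> V"
  obtain W where W: "openin X W" "x \<in> W" "W \<subseteq> V" "subtopology X W homeomorphic_space Euclidean_space (Suc m)"
    using Euclidean_neighbourhood[OF manifold V] .
  have "path_connected_space (subtopology X W)"
    using homeomorphic_path_connected_space[OF W(4)] path_connected_Euclidean_space by blast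
  then have "path_connectedin X W"
    using W(1) openin_subset by (auto simp: path_connectedin_def)
  then show "\<exists>U. openin X U \<and> path_connectedin X U \<and> x \<in> U \<and> U \<subseteq> V"
    using W by blast
qed

text \<open>If \<open>E1\<close> and \<open>E2\<close> disconnect the side, let \<open>g\<close> be the indicator function of the first part. At each point
of \<open>Y\<close>, the germ of \<open>g\<close> is constant or differs by a constant from that of \<open>F\<close>; both conditions are open
and they exclude each other, so by connectedness of \<open>Y\<close> the same one holds everywhere. Then \<open>g\<close> or \<open>g + F\<close>
is locally constant across \<open>Y\<close>, hence constant, which contradicts the values of \<open>g\<close> on the two parts.\<close>

lemma connected_side:
  assumes conn: "connected_space X" "connectedin X Y"
    and F: "locally_constant_off (topspace X) F" and jump: "\<And>y k. y \<in> Y \<Longrightarrow> \<not> agree_near X Y y F (\<lambda>_. k)"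
  shows "connectedin X {w \<in> topspace X - Y. F w}"
proof -
  let ?C = "{w \<in> topspace X - Y. F w}" and ?D = "{w \<in> topspace X - Y. \<not> F w}"
  have openC: "openin X ?C" and openD: "openin X ?D"
    using open_level[OF F, of True] open_level[OF F, of False] by simp_all
  show ?thesis
    unfolding connectedin
  proof (intro conjI notI)
    assume "\<exists>E1 E2. openin X E1 \<and> openin X E2 \<and> ?C \<subseteq> E1 \<union> E2 \<and> E1 \<inter> E2 \<inter> ?C = {} \<and>
              E1 \<inter> ?C \<noteq> {} \<and> E2 \<inter> ?C \<noteq> {}"
    then obtain E1 E2 where E: "openin X E1" "openin X E2" "?C \<subseteq> E1 \<union> E2" "E1 \<inter> E2 \<inter> ?C = {}"
      "E1 \<inter> ?C \<noteq> {}" "E2 \<inter> ?C \<noteq> {}"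
      by blast
    define g where "g = (\<lambda>w. w \<in> E1 \<inter> ?C)"
    have g: "locally_constant_off (topspace X) g"
      unfolding locally_constant_off_def
    proof
      fix x assume x: "x \<in> topspace X - Y"
      then consider "x \<in> E1 \<inter> ?C" | "x \<in> E2 \<inter> ?C" | "x \<in> ?D" using E(3) by blast
      then show "agree_near X Y x g (\<lambda>_. g x)"
      proof cases
        case 1 then show ?thesis
          using E openC by (intro agree_nearI[of X "E1 \<inter> ?C"]) (auto simp: g_def)
      next
        case 2 then show ?thesis
          using E openC by (intro agree_nearI[of X "E2 \<inter> ?C"]) (auto simp: g_def)
      next
        case 3 then show ?thesis
          using openD by (intro agree_nearI[of X ?D]) (auto simp: g_def)
      qed
    qed
    \<comment> \<open>The points where the germs of \<open>g\<close> and \<open>h\<close> differ by a constant; used for \<open>h = F\<close> and for constant \<open>h\<close>.\<close>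
    define R :: "('a \<Rightarrow> bool) \<Rightarrow> 'a set" where "R = (\<lambda>h. {x \<in> topspace X. \<exists>k. agree_near X Y x g (\<lambda>w. k \<noteq> h w)})"
    have openR: "openin X (R h)" for h
    proof (subst openin_subopen, intro ballI)
      fix x assume "x \<in> R h"
      then obtain k where "agree_near X Y x g (\<lambda>w. k \<noteq> h w)" by (auto simp: R_def)
      then obtain N where "openin X N" "x \<in> N" "\<And>w. w \<in> N \<Longrightarrow> agree_near X Y w g (\<lambda>w. k \<noteq> h w)"
        using agree_near_eventually by metis
      then show "\<exists>T. openin X T \<and> x \<in> T \<and> T \<subseteq> R h"
        using openin_subset by (intro exI[of _ N]) (auto simp: R_def)
    qed
    have off: "x \<in> R h" if h: "locally_constant_off (topspace X) h" and x: "x \<in> topspace X - Y" for h x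
    proof -
      have "agree_near X Y x g (\<lambda>_. g x)" "agree_near X Y x h (\<lambda>_. h x)"
        using g h x unfolding locally_constant_off_def by blast+
      then obtain N P where N: "openin X N" "x \<in> N" "\<forall>w\<in>N - Y. g w = g x"
        and P: "openin X P" "x \<in> P" "\<forall>w\<in>P - Y. h w = h x"
        unfolding agree_near_def by blast
      have "agree_near X Y x g (\<lambda>w. (g x \<noteq> h x) \<noteq> h w)"
      proof (rule agree_nearI[of X "N \<inter> P"])
        fix w assume "w \<in> N \<inter> P" "w \<notin> Y"
        then show "g w = ((g x \<noteq> h x) \<noteq> h w)" using N(3) P(3) by auto
      qed (use N P in auto)
      then show ?thesis using x by (auto simp: R_def)
    qed
    let ?c = "\<lambda>_::'a. False"
    have lc: "locally_constant_off (topspace X) ?c"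
      by (auto simp: locally_constant_off_def intro: agree_near_refl)
    have "Y \<subseteq> R ?c \<union> R F"
    proof
      fix y assume y: "y \<in> Y"
      then have yX: "y \<in> topspace X" using closed closedin_subset by blast
      from germ_dichotomy[OF y openin_topspace yX g F] jump[OF y] show "y \<in> R ?c \<union> R F"
        using yX by (auto simp: R_def)
    qed
    moreover have "R ?c \<inter> R F \<inter> Y = {}"
    proof (rule ccontr)
      assume "R ?c \<inter> R F \<inter> Y \<noteq> {}"
      then obtain y k l where y: "y \<in> Y" "agree_near X Y y g (\<lambda>w. k \<noteq> False)" "agree_near X Y y g (\<lambda>w. l \<noteq> F w)"
        by (auto simp: R_def)
      obtain N where N: "openin X N" "y \<in> N" "\<And>w. w \<in> N - Y \<Longrightarrow> g w = (k \<noteq> False)"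
        using y(2) unfolding agree_near_def by blast
      obtain P where P: "openin X P" "y \<in> P" "\<And>w. w \<in> P - Y \<Longrightarrow> g w = (l \<noteq> F w)"
        using y(3) unfolding agree_near_def by blast
      have "agree_near X Y y F (\<lambda>_. l \<noteq> k)"
      proof (rule agree_nearI[of X "N \<inter> P"])
        fix w assume "w \<in> N \<inter> P" "w \<notin> Y"
        then show "F w = (l \<noteq> k)" using N(3)[of w] P(3)[of w] by auto
      qed (use N P in auto)
      then show False using jump y(1) by blast
    qed
    ultimately have "Y \<subseteq> R ?c \<or> Y \<subseteq> R F"
      using connectedinD[OF conn(2) openR[of ?c] openR[of F]] by blast
    then obtain h where h: "Y \<subseteq> R h" "h = ?c \<or> h = F" by blast
    have lch: "locally_constant_off (topspace X) h" using h(2) lc F by auto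
    have "x \<in> R h" if "x \<in> topspace X" for x
      using off[OF lch, of x] h(1) that by blast
    then have "\<exists>k. agree_near X Y x (\<lambda>w. g w \<noteq> h w) (\<lambda>_. k)" if x: "x \<in> topspace X" for x
    proof -
      obtain k where "agree_near X Y x g (\<lambda>w. k \<noteq> h w)"
        using \<open>\<And>x. x \<in> topspace X \<Longrightarrow> x \<in> R h\<close> x by (auto simp: R_def)
      then obtain N where N: "openin X N" "x \<in> N" "\<And>w. w \<in> N - Y \<Longrightarrow> g w = (k \<noteq> h w)"
        unfolding agree_near_def by blast
      have "agree_near X Y x (\<lambda>w. g w \<noteq> h w) (\<lambda>_. k)"
      proof (rule agree_nearI[OF N(1,2)])
        fix w assume "w \<in> N" "w \<notin> Y"
        then show "(g w \<noteq> h w) = k" using N(3)[of w] by auto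
      qed
      then show ?thesis ..
    qed
    moreover have "connectedin X (topspace X)" using conn(1) by (simp add: connectedin_topspace)
    ultimately obtain k where k: "\<And>w. w \<in> topspace X \<Longrightarrow> w \<notin> Y \<Longrightarrow> (g w \<noteq> h w) = k"
      using agree_near_const_on_connected[of X "topspace X" Y "\<lambda>w. g w \<noteq> h w"] complement_dense by blast
    obtain p q where pq: "p \<in> E1 \<inter> ?C" "q \<in> E2 \<inter> ?C" using E by blast
    then have "g p" "\<not> g q" using E(4) by (auto simp: g_def)
    moreover have "h p = h q" using h(2) pq by auto
    moreover have "(g p \<noteq> h p) = (g q \<noteq> h q)" using k[of p] k[of q] pq by auto
    ultimately show False by argo
  qed auto
qed

text \<open>A global section \<open>F\<close> of the bundle of sides is a locally constant function on the complement that jumps at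
every point of \<open>Y\<close>. Its two level sets are the components.\<close>

theorem two_components:
  assumes conn: "connected_space X" "connectedin X Y" and "Y \<noteq> {}" and "no_mod2_cohomology X"
  shows "card (connected_components_of (subtopology X (topspace X - Y))) = 2"
proof -
  interpret double_cover X Y germ_at by (rule double_cover_sides)
  have "path_connected_space X"
    using conn(1) locally_path_connected path_connected_eq_connected_space by blast
  then obtain F where F: "\<And>x. x \<in> topspace X \<Longrightarrow> \<exists>k. agree_near X Y x F (\<lambda>w. k \<noteq> germ_at x w)"
    using global_section_exists[OF assms(4) _ locally_path_connected] by metis
  have Y_sub: "Y \<subseteq> topspace X" using closed closedin_subset by blast
  have lc: "locally_constant_off (topspace X) F"
    unfolding locally_constant_off_def
  proof
    fix x assume x: "x \<in> topspace X - Y"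
    then obtain k where "agree_near X Y x F (\<lambda>w. k \<noteq> germ_at x w)" using F by blast
    then have k: "agree_near X Y x F (\<lambda>_. k)" using x by (simp add: germ_at_def)
    then have "F x = k" using x unfolding agree_near_def by blast
    with k show "agree_near X Y x F (\<lambda>_. F x)" by simp
  qed
  have jump: "\<not> agree_near X Y y F (\<lambda>_. k)" if y: "y \<in> Y" for y k
  proof
    assume "agree_near X Y y F (\<lambda>_. k)"
    then obtain N where N: "openin X N" "y \<in> N" "\<And>w. w \<in> N - Y \<Longrightarrow> F w = k"
      unfolding agree_near_def by blast
    obtain l where "agree_near X Y y F (\<lambda>w. l \<noteq> (w \<in> side_at y))"
      using F[of y] Y_sub y by (auto simp: germ_at_def)
    then obtain P where P: "openin X P" "y \<in> P" "\<And>w. w \<in> P - Y \<Longrightarrow> F w = (l \<noteq> (w \<in> side_at y))"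
      unfolding agree_near_def by blast
    have "agree_near X Y y (\<lambda>w. w \<in> side_at y) (\<lambda>_. l \<noteq> k)"
    proof (rule agree_nearI[of X "N \<inter> P"])
      fix w assume "w \<in> N \<inter> P" "w \<notin> Y"
      then show "(w \<in> side_at y) = (l \<noteq> k)" using N(3)[of w] P(3)[of w] by auto
    qed (use N P in auto)
    moreover obtain W M B where "local_sides W M (side_at y) B" "y \<in> M" using side_at[OF y] .
    ultimately show False using sides_jump by blast
  qed
  have neg: "agree_near X Y x (\<lambda>w. \<not> F w) (\<lambda>_. k) \<longleftrightarrow> agree_near X Y x F (\<lambda>_. \<not> k)" for x k
    unfolding agree_near_def by blast
  let ?C = "{w \<in> topspace X - Y. F w}" and ?D = "{w \<in> topspace X - Y. \<not> F w}"
  have C: "connectedin X ?C" by (rule connected_side[OF conn lc jump])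
  have D: "connectedin X ?D"
  proof (rule connected_side[OF conn])
    show "locally_constant_off (topspace X) (\<lambda>w. \<not> F w)"
      using lc by (simp add: locally_constant_off_def neg)
    show "\<not> agree_near X Y y (\<lambda>w. \<not> F w) (\<lambda>_. k)" if "y \<in> Y" for y k
      using jump[OF that] by (simp add: neg)
  qed
  have ne: "{w \<in> topspace X - Y. F w = c} \<noteq> {}" for c
  proof
    assume empty: "{w \<in> topspace X - Y. F w = c} = {}"
    obtain y where "y \<in> Y" using \<open>Y \<noteq> {}\<close> by blast
    moreover have "agree_near X Y y F (\<lambda>_. \<not> c)"
      using empty \<open>y \<in> Y\<close> Y_sub by (intro agree_nearI[of X "topspace X"]) auto
    ultimately show False using jump by blast
  qed
  have "connected_components_of (subtopology X (topspace X - Y)) = {?C, ?D}"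
  proof (rule connected_components_of_two)
    show "openin (subtopology X (topspace X - Y)) ?C" "openin (subtopology X (topspace X - Y)) ?D"
      using open_level[OF lc, of True] open_level[OF lc, of False]
      by (auto intro: openin_subset_topspace_eq[THEN iffD1] simp: openin_subtopology_alt)
    show "connectedin (subtopology X (topspace X - Y)) ?C" "connectedin (subtopology X (topspace X - Y)) ?D"
      using C D by (auto simp: connectedin_subtopology)
    show "?C \<noteq> {}" "?D \<noteq> {}" using ne[of True] ne[of False] by simp_all
  qed auto
  moreover have "?C \<noteq> ?D" using ne[of True] by auto
  ultimately show ?thesis by simp
qed

end

theorem theorem4:
  fixes n :: nat and X :: "'a topology" and Y :: "'a set"
  assumes "n > 1"
    and "topological_manifold n X"
    and "topological_submanifold (n - 1) X Y"
    and "connected_space X" and "topspace X \<noteq> {}"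
    and "connectedin X Y" and "Y \<noteq> {}"
    and "closedin X Y"
    and "\<forall>h \<in> hom (homology_group 1 X) (integer_mod_group 2).
           trivial_homomorphism (homology_group 1 X) (integer_mod_group 2) h"
  shows "card (connected_components_of (subtopology X (topspace X - Y))) = 2"
proof -
  interpret closed_hypersurface X Y "n - 1"
    by unfold_locales (use assms in simp_all)
  show ?thesis
    using two_components assms by (simp add: no_mod2_cohomology_def)
qed

end
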